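(* Let $\varepsilon\ge0$ and $\delta\ge0$, and suppose that $f(\bm z)<+\infty$ for at least one $\bm z\in\mathcal Z_N^k$. The bilevel cutting-plane algorithm with tolerances $\varepsilon,\delta$ terminates in a finite number of iterations and outputs a $\max\{\delta,\varepsilon\}$-optimal solution $\hat{\bm z}$ of the upper-level problem of minimizing $f(\bm z)$ subject to $\bm z\in\mathcal Z_N^k$; that is, $\hat{\bm z}\in\mathcal Z_N^k$ and $$f^\star\le f(\hat{\bm z})\le f^\star+\max\{\delta,\varepsilon\},$$ where $f^\star=\min_{\bm z\in\mathcal Z_N^k}f(\bm z)$.
   Context: Data: positive integers $N,M,S,k$; $\mathcal N=\{1,\dots,N\}$, $\mathcal S=\{1,\dots,S\}$; scenario return vectors $\bm r^{(s)}\in\mathbb R^N$; probabilities $p_s\ge0$ with $\sum_{s\in\mathcal S}p_s=1$; $\beta\in(0,1)$; $\gamma>0$; $\bm A\in\mathbb R^{M\times N}$, $\bm b\in\mathbb R^M$. $\mathcal X=\{\bm x\in\mathbb R^N\mid \bm A\bm x\le\bm b,\ \bm 1^\top\bm x=1,\ \bm x\ge\bm 0\}$, $\mathcal Z_N^k=\{\bm z\in\{0,1\}^N\mid\sum_{n\in\mathcal N}z_n\le k\}$, $\bm Z=\mathrm{Diag}(\bm z)$, $[\xi]_+=\max\{0,\xi\}$, $\circ$ is the entrywise product, and vector inequalities are entrywise. For $\bm z\in\mathcal Z_N^k$, $f(\bm z)$ is the optimal value ($+\infty$ if infeasible) of the lower-level problem: minimize $\frac1{2\gamma}\bm x^\top\bm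 x+a+v$ over $a,v\in\mathbb R$, $\bm x\in\mathbb R^N$ subject to $v\ge\frac1{1-\beta}\sum_{s\in\mathcal S}p_s[-(\bm r^{(s)})^\top\bm Z\bm x-a]_+$ and $\bm Z\bm x\in\mathcal X$. Problem $D_{\mathcal K}(\bm z)$, for a family $\mathcal K$ of subsets of $\mathcal S$: maximize $-\frac\gamma2\bm z^\top(\bm\omega\circ\bm\omega)-\bm b^\top\bm\zeta+\lambda$ over $\bm\alpha=(\alpha_{\mathcal J})_{\mathcal J\in\mathcal K},\bm\zeta\in\mathbb R^M,\lambda\in\mathbb R,\bm\omega\in\mathbb R^N$ subject to $\bm\omega\ge\frac1{1-\beta}\sum_{\mathcal J\in\mathcal K}\alpha_{\mathcal J}\sum_{s\in\mathcal J}p_s\bm r^{(s)}-\bm A^\top\bm\zeta+\lambda\bm1$, $\sum_{\mathcal J\in\mathcal K}\alpha_{\mathcal J}\le1$, $\sum_{\mathcal J\in\mathcal K}\alpha_{\mathcal J}\sum_{s\in\mathcal J}p_s=1-\beta$, $\bm\alpha\ge\bm0$, $\bm\zeta\ge\bm0$. Lower-level cutting-plane algorithm (input $\bm z\in\mathcal Z_N^k$, tolerance $\delta\ge0$). Initialize $t=1$ and $\mathcal G_1(\bm z)=\{(a,v,\bm x)\in\mathbb R\times\mathbb R\times\mathbb R^N\mid v\ge\frac1{1-\beta}\sum_{s\in\mathcal S}p_s(-(\bm r^{(s)})^\top\bm Z\bm x-a),\ v\ge0,\ \bm Z\bm x\in\mathcal X\}$ (if this set is empty, the lower-level problem is infeasible).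 At iteration $t$: (1) let $(a_t,v_t,\bm x_t)$ be an optimal solution of minimizing $\frac1{2\gamma}\bm x^\top\bm x+a+v$ over $(a,v,\bm x)\in\mathcal G_t(\bm z)$; (2) set $\mathcal J_t=\{s\in\mathcal S\mid-(\bm r^{(s)})^\top\bm Z\bm x_t-a_t>0\}$ and $v'_t=\frac1{1-\beta}\sum_{s\in\mathcal J_t}p_s(-(\bm r^{(s)})^\top\bm Z\bm x_t-a_t)$; (3) if $v'_t-v_t\le\delta$, terminate; (4) otherwise set $\mathcal G_{t+1}(\bm z)=\mathcal G_t(\bm z)\cap\{(a,v,\bm x)\mid v\ge\frac1{1-\beta}\sum_{s\in\mathcal J_t}p_s(-(\bm r^{(s)})^\top\bm Z\bm x-a)\}$, and increase $t$ by one. If it terminates at iteration $\tau$, it outputs $(\hat a,\hat v,\hat{\bm x})=(a_\tau,v'_\tau,\bm x_\tau)$ and $\mathcal K_\delta(\bm z)=\{\mathcal S,\mathcal J_1,\dots,\mathcal J_\tau\}$; set $f_\delta(\bm z)=\frac1{2\gamma}\bm x_\tau^\top\bm x_\tau+a_\tau+v_\tau$ and $\hat f_\delta(\bm z)=\frac1{2\gamma}\hat{\bm x}^\top\hat{\bm x}+\hat a+\hat v$. (It is known from earlier work that this algorithm terminates in finitely many iterations.) Bilevel cutting-plane algorithm (tolerances $\varepsilon,\delta\ge0$). Let $\theta_{\mathrm{LB}}\in\mathbb R$ be a lower bound on $f^\star$. Step 0: set $\mathcal F_1=\{(\bm z,\theta)\in\mathcal Z_N^k\times\mathbb R\mid\theta\ge\theta_{\mathrm{LB}}\}$,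 $t=1$, $\mathrm{UB}_0=\infty$. Step 1: let $(\bm z_t,\theta_t)$ be an optimal solution of minimizing $\theta$ over $(\bm z,\theta)\in\mathcal F_t$; set $\mathrm{LB}_t=\theta_t$. Step 2: apply the lower-level cutting-plane algorithm with tolerance $\delta$ to $\bm z=\bm z_t$. (a) If the lower-level problem is infeasible, set $\mathrm{UB}_t=\mathrm{UB}_{t-1}$ and $\mathcal F_{t+1}=\mathcal F_t\cap\{(\bm z,\theta)\in\mathcal Z_N^k\times\mathbb R\mid\bm z_t^\top(\bm1-\bm z)+(\bm1-\bm z_t)^\top\bm z\ge1\}$. (b) If it is feasible, let $\bm\omega_\delta^\star(\bm z_t)$ be the $\bm\omega$-part of an optimal solution of $D_{\mathcal K}(\bm z_t)$ with $\mathcal K=\mathcal K_\delta(\bm z_t)$, set $\bm g_\delta(\bm z_t)=-\frac\gamma2\bm\omega_\delta^\star(\bm z_t)\circ\bm\omega_\delta^\star(\bm z_t)$ and $\mathcal F_{t+1}=\mathcal F_t\cap\{(\bm z,\theta)\in\mathcal Z_N^k\times\mathbb R\mid\theta\ge f_\delta(\bm z_t)+\bm g_\delta(\bm z_t)^\top(\bm z-\bm z_t)\}$; if $\hat f_\delta(\bm z_t)<\mathrm{UB}_{t-1}$, set $\mathrm{UB}_t=\hat f_\delta(\bm z_t)$ and $(\hat{\bm z},\hat\theta)=(\bm z_t,\theta_t)$, otherwise set $\mathrm{UB}_t=\mathrm{UB}_{t-1}$. Step 3: if $\bm z_u=\bm z_t$ for some $u<t$ or $\mathrm{UB}_t-\mathrm{LB}_t\le\varepsilon$,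 terminate with output $\hat{\bm z}$. Step 4: increase $t$ by one and return to Step 1. *)

theory Defs
  imports "HOL-Analysis.Analysis"
begin

(* The index sets {1..N}, {1..M} and {1..S} are the finite types 'n, 'm and 's.  On real ^ 'n the
   library order, product and unit are entrywise. *)

record ('n, 'm, 's) portfolio_data =
  ret :: "'s \<Rightarrow> real ^ 'n"
  prob :: "'s \<Rightarrow> real"
  conf_level :: real
  regularizer :: real
  lhs_mat :: "real ^ 'n ^ 'm"
  rhs_vec :: "real ^ 'm"
  max_assets :: nat

definition valid_data :: "('n::finite, 'm::finite, 's::finite) portfolio_data \<Rightarrow> bool" where
  "valid_data D \<longleftrightarrow>
     (\<forall>s. 0 \<le> prob D s) \<and> (\<Sum>s\<in>UNIV. prob D s) = 1 \<and>
     0 < conf_level D \<and> conf_level D < 1 \<and> 0 < regularizer D \<and> 0 < max_assets D"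

definition Diag :: "real ^ 'n \<Rightarrow> real ^ 'n ^ 'n::finite" where
  "Diag z = (\<chi> i j. if i = j then z $ i else 0)"

definition portfolios :: "('n::finite, 'm::finite, 's::finite) portfolio_data \<Rightarrow> (real ^ 'n) set" where
  "portfolios D = {x. lhs_mat D *v x \<le> rhs_vec D \<and> 1 \<bullet> x = 1 \<and> 0 \<le> x}"

definition supports :: "('n::finite, 'm::finite, 's::finite) portfolio_data \<Rightarrow> (real ^ 'n) set" where
  "supports D = {z. (\<forall>n. z $ n \<in> {0, 1}) \<and> (\<Sum>n\<in>UNIV. z $ n) \<le> real (max_assets D)}"

definition excess_loss ::
  "('n::finite, 'm::finite, 's::finite) portfolio_data \<Rightarrow> real ^ 'n \<Rightarrow> real \<Rightarrow> real ^ 'n \<Rightarrow> 's \<Rightarrow> real" where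
  "excess_loss D z a x s = - (ret D s \<bullet> (Diag z *v x)) - a"

definition lower_objective ::
  "('n::finite, 'm::finite, 's::finite) portfolio_data \<Rightarrow> real \<times> real \<times> (real ^ 'n) \<Rightarrow> real" where
  "lower_objective D = (\<lambda>(a, v, x). 1 / (2 * regularizer D) * (x \<bullet> x) + a + v)"

definition lower_feasible ::
  "('n::finite, 'm::finite, 's::finite) portfolio_data \<Rightarrow> real ^ 'n \<Rightarrow> (real \<times> real \<times> (real ^ 'n)) set" where
  "lower_feasible D z =
     {(a, v, x). v \<ge> 1 / (1 - conf_level D) * (\<Sum>s\<in>UNIV. prob D s * max 0 (excess_loss D z a x s)) \<and>
                 Diag z *v x \<in> portfolios D}"

definition lower_value ::
  "('n::finite, 'm::finite, 's::finite) portfolio_data \<Rightarrow> real ^ 'n \<Rightarrow> ereal" where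
  "lower_value D z = (INF w\<in>lower_feasible D z. ereal (lower_objective D w))"

definition optimal_value :: "('n::finite, 'm::finite, 's::finite) portfolio_data \<Rightarrow> ereal" where
  "optimal_value D = Min (lower_value D ` supports D)"


definition dual_objective ::
  "('n::finite, 'm::finite, 's::finite) portfolio_data \<Rightarrow> real ^ 'n
     \<Rightarrow> ('s set \<Rightarrow> real) \<times> (real ^ 'm) \<times> real \<times> (real ^ 'n) \<Rightarrow> real" where
  "dual_objective D z =
     (\<lambda>(\<alpha>, \<zeta>, l, \<omega>). - (regularizer D / 2) * (z \<bullet> (\<omega> * \<omega>)) - rhs_vec D \<bullet> \<zeta> + l)"

(* The multipliers alpha are constrained on the family K only; their values elsewhere are irrelevant. *)
definition dual_feasible ::
  "('n::finite, 'm::finite, 's::finite) portfolio_data \<Rightarrow> 's set set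
     \<Rightarrow> (('s set \<Rightarrow> real) \<times> (real ^ 'm) \<times> real \<times> (real ^ 'n)) set" where
  "dual_feasible D K =
     {(\<alpha>, \<zeta>, l, \<omega>).
        \<omega> \<ge> (1 / (1 - conf_level D)) *\<^sub>R (\<Sum>J\<in>K. \<alpha> J *\<^sub>R (\<Sum>s\<in>J. prob D s *\<^sub>R ret D s))
              - transpose (lhs_mat D) *v \<zeta> + l *\<^sub>R 1 \<and>
        (\<Sum>J\<in>K. \<alpha> J) \<le> 1 \<and>
        (\<Sum>J\<in>K. \<alpha> J * (\<Sum>s\<in>J. prob D s)) = 1 - conf_level D \<and>
        (\<forall>J\<in>K. 0 \<le> \<alpha> J) \<and> 0 \<le> \<zeta>}"

definition dual_optimal ::
  "('n::finite, 'm::finite, 's::finite) portfolio_data \<Rightarrow> 's set set \<Rightarrow> real ^ 'n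
     \<Rightarrow> ('s set \<Rightarrow> real) \<times> (real ^ 'm) \<times> real \<times> (real ^ 'n) \<Rightarrow> bool" where
  "dual_optimal D K z = is_arg_max (dual_objective D z) (\<lambda>y. y \<in> dual_feasible D K)"


(* Both algorithms choose arbitrary optimal solutions, so they are nondeterministic transition
   systems.  Termination of such a system means that no execution is infinite and that no
   execution gets stuck before reaching a final state. *)
definition terminates :: "('c \<Rightarrow> 'c \<Rightarrow> bool) \<Rightarrow> 'c \<Rightarrow> ('c \<Rightarrow> bool) \<Rightarrow> bool" where
  "terminates step init final \<longleftrightarrow>
     \<not> (\<exists>\<sigma>. \<sigma> 0 = init \<and> (\<forall>i::nat. step (\<sigma> i) (\<sigma> (Suc i)))) \<and>
     (\<forall>c. step\<^sup>*\<^sup>* init c \<and> \<not> final c \<longrightarrow> (\<exists>c'. step c c'))"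


definition tail_cut ::
  "('n::finite, 'm::finite, 's::finite) portfolio_data \<Rightarrow> real ^ 'n \<Rightarrow> 's set
     \<Rightarrow> (real \<times> real \<times> (real ^ 'n)) set" where
  "tail_cut D z J =
     {(a, v, x). v \<ge> 1 / (1 - conf_level D) * (\<Sum>s\<in>J. prob D s * excess_loss D z a x s)}"

definition lower_initial_set ::
  "('n::finite, 'm::finite, 's::finite) portfolio_data \<Rightarrow> real ^ 'n \<Rightarrow> (real \<times> real \<times> (real ^ 'n)) set" where
  "lower_initial_set D z = tail_cut D z UNIV \<inter> {(a, v, x). v \<ge> 0 \<and> Diag z *v x \<in> portfolios D}"

definition tail_scenarios ::
  "('n::finite, 'm::finite, 's::finite) portfolio_data \<Rightarrow> real ^ 'n \<Rightarrow> real \<Rightarrow> real ^ 'n \<Rightarrow> 's set" where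
  "tail_scenarios D z a x = {s. excess_loss D z a x s > 0}"

definition tail_value ::
  "('n::finite, 'm::finite, 's::finite) portfolio_data \<Rightarrow> real ^ 'n \<Rightarrow> real \<Rightarrow> real ^ 'n \<Rightarrow> real" where
  "tail_value D z a x =
     1 / (1 - conf_level D) * (\<Sum>s\<in>tail_scenarios D z a x. prob D s * excess_loss D z a x s)"

(* Lower_Running G K: at the start of iteration t, G is the relaxed feasible set of this iteration
   and K = {S, J_1, ..., J_(t-1)}.
   Lower_Done a v v' x K: the last solution (a, v, x), the corrected value v' and the final family K. *)
datatype ('n, 's) lower_state =
    Lower_Running "(real \<times> real \<times> (real ^ 'n)) set" "'s set set"
  | Lower_Done real real real "real ^ 'n" "'s set set"

definition lower_init ::
  "('n::finite, 'm::finite, 's::finite) portfolio_data \<Rightarrow> real ^ 'n \<Rightarrow> ('n, 's) lower_state" where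
  "lower_init D z = Lower_Running (lower_initial_set D z) {UNIV}"

inductive lower_step ::
  "('n::finite, 'm::finite, 's::finite) portfolio_data \<Rightarrow> real \<Rightarrow> real ^ 'n
     \<Rightarrow> ('n, 's) lower_state \<Rightarrow> ('n, 's) lower_state \<Rightarrow> bool"
  for D :: "('n::finite, 'm::finite, 's::finite) portfolio_data" and \<delta> :: real and z :: "real ^ 'n"
where
  lower_stop:
    "\<lbrakk> is_arg_min (lower_objective D) (\<lambda>w. w \<in> G) (a, v, x);
       J = tail_scenarios D z a x; v' = tail_value D z a x; v' - v \<le> \<delta> \<rbrakk>
     \<Longrightarrow> lower_step D \<delta> z (Lower_Running G K) (Lower_Done a v v' x (insert J K))"
| lower_continue:
    "\<lbrakk> is_arg_min (lower_objective D) (\<lambda>w. w \<in> G) (a, v, x);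
       J = tail_scenarios D z a x; v' = tail_value D z a x; \<not> v' - v \<le> \<delta> \<rbrakk>
     \<Longrightarrow> lower_step D \<delta> z (Lower_Running G K) (Lower_Running (G \<inter> tail_cut D z J) (insert J K))"

definition lower_done :: "('n::finite, 's::finite) lower_state \<Rightarrow> bool" where
  "lower_done c \<longleftrightarrow> (\<exists>a v v' x K. c = Lower_Done a v v' x K)"


(* At the start of iteration t: master_set is F_t, upper_bound is UB_(t-1), incumbent is the pair
   (z hat, theta hat) if one has been recorded, and visited = {z_u | u < t}.  The pair is the output
   once halted holds. *)
record 'n bilevel_state =
  master_set :: "((real ^ 'n) \<times> real) set"
  upper_bound :: ereal
  incumbent :: "((real ^ 'n) \<times> real) option"
  visited :: "(real ^ 'n) set"
  halted :: bool

definition bilevel_init ::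
  "('n::finite, 'm::finite, 's::finite) portfolio_data \<Rightarrow> real \<Rightarrow> 'n bilevel_state" where
  "bilevel_init D \<theta>\<^sub>L\<^sub>B =
     \<lparr> master_set = {(z, \<theta>). z \<in> supports D \<and> \<theta> \<ge> \<theta>\<^sub>L\<^sub>B}, upper_bound = \<infinity>,
       incumbent = None, visited = {}, halted = False \<rparr>"

(* In both rules LB_t is theta, and (a, v, x), v' and K are the results of the lower-level algorithm,
   so that f_delta(z) and its corrected version use v and v', respectively. *)
inductive bilevel_step ::
  "('n::finite, 'm::finite, 's::finite) portfolio_data \<Rightarrow> real \<Rightarrow> real
     \<Rightarrow> 'n bilevel_state \<Rightarrow> 'n bilevel_state \<Rightarrow> bool"
  for D :: "('n::finite, 'm::finite, 's::finite) portfolio_data" and \<epsilon> \<delta> :: real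
where
  infeasible_cut:
    "\<lbrakk> \<not> halted \<sigma>;
       is_arg_min snd (\<lambda>y. y \<in> master_set \<sigma>) (z, \<theta>);
       lower_initial_set D z = {};
       UB = upper_bound \<sigma> \<rbrakk>
     \<Longrightarrow> bilevel_step D \<epsilon> \<delta> \<sigma>
           \<lparr> master_set = master_set \<sigma> \<inter>
               {(z', \<theta>'). z' \<in> supports D \<and> z \<bullet> (1 - z') + (1 - z) \<bullet> z' \<ge> 1},
             upper_bound = UB,
             incumbent = incumbent \<sigma>,
             visited = insert z (visited \<sigma>),
             halted = (z \<in> visited \<sigma> \<or> UB - ereal \<theta> \<le> ereal \<epsilon>) \<rparr>"
| optimality_cut:
    "\<lbrakk> \<not> halted \<sigma>;
       is_arg_min snd (\<lambda>y. y \<in> master_set \<sigma>) (z, \<theta>);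
       lower_initial_set D z \<noteq> {};
       (lower_step D \<delta> z)\<^sup>*\<^sup>* (lower_init D z) (Lower_Done a v v' x K);
       f\<^sub>\<delta> = lower_objective D (a, v, x);
       fhat = lower_objective D (a, v', x);
       dual_optimal D K z (\<alpha>, \<zeta>, l, \<omega>);
       g = - (regularizer D / 2) *\<^sub>R (\<omega> * \<omega>);
       (UB, inc) = (if ereal fhat < upper_bound \<sigma> then (ereal fhat, Some (z, \<theta>))
                    else (upper_bound \<sigma>, incumbent \<sigma>)) \<rbrakk>
     \<Longrightarrow> bilevel_step D \<epsilon> \<delta> \<sigma>
           \<lparr> master_set = master_set \<sigma> \<inter>
               {(z', \<theta>'). z' \<in> supports D \<and> \<theta>' \<ge> f\<^sub>\<delta> + g \<bullet> (z' - z)},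
             upper_bound = UB,
             incumbent = inc,
             visited = insert z (visited \<sigma>),
             halted = (z \<in> visited \<sigma> \<or> UB - ereal \<theta> \<le> ereal \<epsilon>) \<rparr>"

end

theory Submission
  imports Defs
begin

text \<open>
The function \<open>f\<close> is approximated from below by cuts, and everything rests on convex duality for the
polyhedral relaxations \<open>relaxed_set D z K\<close> of the lower-level problem.

The lower-level algorithm minimises over such relaxations. A minimum exists because the objective is
coercive there (lemma \<open>relaxed_minimum_exists\<close>). If the tail of the minimiser is already in the
family, then its cut is satisfied and the algorithm stops; since there are finitely many scenario sets, it
terminates. Its result brackets \<open>f z\<close>: the relaxed minimum lies below, and replacing \<open>v\<close> by the exact tail value
gives a feasible point at most \<open>\<delta>\<close> above that minimum.

The dual problem of a relaxation has a feasible set that is the same for all \<open>z\<close>, and an objective that is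
affine in \<open>z\<close>. Weak duality (\<open>weak_duality\<close>) therefore turns each dual point into an affine minorant of \<open>f\<close>
over all supports. Strong duality with attainment (\<open>dual_certificate\<close>), which is Farkas' lemma applied to the
linearisation of the objective at the minimiser, shows that a dual optimum exists, so that the next cut
can always be formed, and that the minorant at the current support reaches at least the relaxed minimum.

The master problem is thus always a relaxation of the upper-level problem, and its optimal value \<open>\<theta>\<close> is
a lower bound for the optimal value. If the gap criterion stops the algorithm, then the incumbent is
\<open>\<epsilon>\<close>-optimal. If instead a support is repeated, then this support was feasible, as infeasible ones are cut
off for good; its own cut forces \<open>\<theta>\<close> up to the relaxed minimum there, which is within \<open>\<delta>\<close> of the upper bound
recorded at that visit. As there are finitely many supports, one of the two happens after finitely many iterations.
The invariant \<open>bilevel_invariant\<close> collects these facts.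
\<close>

section \<open>Polyhedral relaxations of the lower-level problem\<close>

definition tail_mass :: "('n::finite, 'm::finite, 's::finite) portfolio_data \<Rightarrow> 's set \<Rightarrow> real" where
  "tail_mass D J = (\<Sum>s\<in>J. prob D s)"

definition tail_return ::
  "('n::finite, 'm::finite, 's::finite) portfolio_data \<Rightarrow> 's set \<Rightarrow> real ^ 'n" where
  "tail_return D J = (\<Sum>s\<in>J. prob D s *\<^sub>R ret D s)"

text \<open>The cut generated by a scenario set reads \<open>0 \<le> tail_slack\<close>, and the slack is linear in \<open>(a, v, x)\<close>.
This homogeneity is what the conic duality argument uses.\<close>

definition tail_slack ::
  "('n::finite, 'm::finite, 's::finite) portfolio_data \<Rightarrow> real ^ 'n \<Rightarrow> 's set
     \<Rightarrow> real \<Rightarrow> real \<Rightarrow> real ^ 'n \<Rightarrow> real" where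
  "tail_slack D z J a v x =
     1 / (1 - conf_level D) * (tail_mass D J * a + tail_return D J \<bullet> (z * x)) + v"

text \<open>The lower-level algorithm only ever works with these polyhedra: the constraint on \<open>v\<close>, which involves
positive parts, is replaced by its linear consequences for the scenario sets in \<open>K\<close>, one half-space for each.\<close>

definition relaxed_set ::
  "('n::finite, 'm::finite, 's::finite) portfolio_data \<Rightarrow> real ^ 'n \<Rightarrow> 's set set
     \<Rightarrow> (real \<times> real \<times> (real ^ 'n)) set" where
  "relaxed_set D z K =
     {(a, v, x). 0 \<le> v \<and> Diag z *v x \<in> portfolios D} \<inter> (\<Inter>J\<in>K. tail_cut D z J)"

lemma Diag_mult_vec: "Diag z *v x = z * x"
  by (simp add: Diag_def matrix_vector_mult_def vec_eq_iff if_distrib[of "\<lambda>c. c * _"] cong: if_cong)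

lemma inner_one_mult_vec: "1 \<bullet> (z * x) = z \<bullet> (x :: real ^ 'n::finite)"
  by (simp add: inner_vec_def)

lemma sum_excess_loss:
  "(\<Sum>s\<in>J. prob D s * excess_loss D z a x s)
     = - (tail_return D J \<bullet> (z * x)) - tail_mass D J * a"
  by (simp add: excess_loss_def tail_return_def tail_mass_def Diag_mult_vec inner_sum_left
      sum_distrib_right sum_subtractf right_diff_distrib sum_negf)

lemma mem_tail_cut:
  "(a, v, x) \<in> tail_cut D z J \<longleftrightarrow> 0 \<le> tail_slack D z J a v x"
proof -
  have "1 / (1 - conf_level D) * (- (tail_return D J \<bullet> (z * x)) - tail_mass D J * a)
      = - (1 / (1 - conf_level D) * (tail_mass D J * a + tail_return D J \<bullet> (z * x)))"
    by (simp add: algebra_simps)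
  then show ?thesis
    by (simp only: tail_slack_def tail_cut_def sum_excess_loss mem_Collect_eq case_prod_conv) linarith
qed

lemma mem_relaxed_set:
  "(a, v, x) \<in> relaxed_set D z K \<longleftrightarrow>
     0 \<le> v \<and> lhs_mat D *v (z * x) \<le> rhs_vec D \<and> z \<bullet> x = 1 \<and> 0 \<le> z * x \<and>
     (\<forall>J\<in>K. 0 \<le> tail_slack D z J a v x)"
  unfolding relaxed_set_def portfolios_def
  by (auto simp: mem_tail_cut Diag_mult_vec inner_one_mult_vec)

lemma lower_initial_set_eq: "lower_initial_set D z = relaxed_set D z {UNIV}"
  unfolding lower_initial_set_def relaxed_set_def by auto

lemma relaxed_set_insert: "relaxed_set D z (insert J K) = relaxed_set D z K \<inter> tail_cut D z J"
  unfolding relaxed_set_def by auto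

lemma tail_sum_le_positive_part_sum:
  assumes "valid_data D"
  shows "(\<Sum>s\<in>J. prob D s * excess_loss D z a x s)
           \<le> (\<Sum>s\<in>UNIV. prob D s * max 0 (excess_loss D z a x s))"
proof -
  have "(\<Sum>s\<in>J. prob D s * excess_loss D z a x s)
          \<le> (\<Sum>s\<in>J. prob D s * max 0 (excess_loss D z a x s))"
    using assms by (intro sum_mono mult_left_mono) (auto simp: valid_data_def)
  also have "\<dots> \<le> (\<Sum>s\<in>UNIV. prob D s * max 0 (excess_loss D z a x s))"
    using assms by (intro sum_mono2) (auto simp: valid_data_def)
  finally show ?thesis .
qed

text \<open>A partial sum of losses never exceeds the sum of all positive parts, so every cut is a consequence of
the exact constraint. The cut for the empty set is \<open>0 \<le> v\<close>.\<close>

lemma lower_feasible_subset_relaxed: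
  assumes "valid_data D"
  shows "lower_feasible D z \<subseteq> relaxed_set D z K"
proof (rule subsetI, clarify)
  fix a v x assume "(a, v, x) \<in> lower_feasible D z"
  then have v: "1 / (1 - conf_level D) * (\<Sum>s\<in>UNIV. prob D s * max 0 (excess_loss D z a x s)) \<le> v"
    and x: "Diag z *v x \<in> portfolios D" by (auto simp: lower_feasible_def)
  have "0 \<le> 1 / (1 - conf_level D)" using assms by (simp add: valid_data_def)
  then have cut: "1 / (1 - conf_level D) * (\<Sum>s\<in>J. prob D s * excess_loss D z a x s) \<le> v" for J
    using v tail_sum_le_positive_part_sum[OF assms] by (meson mult_left_mono order_trans)
  from cut[of "{}"] have "0 \<le> v" by simp
  then show "(a, v, x) \<in> relaxed_set D z K"
    using cut x unfolding relaxed_set_def tail_cut_def by auto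
qed

text \<open>For the tail of the point itself the cut loses nothing: the scenarios left out contribute zero to the
positive-part sum. Hence replacing \<open>v\<close> by this value repairs any point of a relaxation.\<close>

lemma tail_value_eq:
  "tail_value D z a x =
     1 / (1 - conf_level D) * (\<Sum>s\<in>UNIV. prob D s * max 0 (excess_loss D z a x s))"
proof -
  have "(\<Sum>s\<in>tail_scenarios D z a x. prob D s * excess_loss D z a x s)
      = (\<Sum>s\<in>UNIV. prob D s * max 0 (excess_loss D z a x s))"
    by (rule sum.mono_neutral_cong_left) (auto simp: tail_scenarios_def)
  then show ?thesis by (simp add: tail_value_def)
qed

lemma corrected_point_lower_feasible:
  assumes "(a, v, x) \<in> relaxed_set D z K"
  shows "(a, tail_value D z a x, x) \<in> lower_feasible D z"
  using assms by (simp add: relaxed_set_def lower_feasible_def tail_value_eq)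

lemma lower_initial_set_empty_iff:
  assumes "valid_data D"
  shows "lower_initial_set D z = {} \<longleftrightarrow> lower_feasible D z = {}"
proof -
  have "lower_feasible D z \<noteq> {}" if "lower_initial_set D z \<noteq> {}"
    using that corrected_point_lower_feasible[of _ _ _ D z "{UNIV}"]
    unfolding lower_initial_set_eq by fast
  then show ?thesis
    using lower_feasible_subset_relaxed[OF assms, of z "{UNIV}"] lower_initial_set_eq[of D z] by blast
qed

lemma relaxed_set_nonempty:
  assumes "valid_data D" "lower_initial_set D z \<noteq> {}"
  shows "relaxed_set D z K \<noteq> {}"
  using assms lower_feasible_subset_relaxed lower_initial_set_empty_iff by blast

lemma supports_binary: "z \<in> supports D \<Longrightarrow> z $ n = 0 \<or> z $ n = 1"
  by (auto simp: supports_def)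

text \<open>A binary vector is determined by the set of its nonzero coordinates.\<close>

lemma finite_supports:
  fixes D :: "('n::finite, 'm::finite, 's::finite) portfolio_data"
  shows "finite (supports D)"
proof -
  have "supports D \<subseteq> (\<lambda>A. \<chi> n. if n \<in> A then 1 else 0) ` UNIV"
  proof
    fix z :: "real ^ 'n" assume "z \<in> supports D"
    then have "z = (\<chi> n. if n \<in> {n. z $ n = 1} then 1 else 0)"
      using supports_binary by (fastforce simp: vec_eq_iff)
    then show "z \<in> (\<lambda>A. \<chi> n. if n \<in> A then 1 else 0) ` UNIV" by blast
  qed
  then show ?thesis by (rule finite_subset) simp
qed

section \<open>Existence of minimisers\<close>

lemma continuous_on_mult_vec [continuous_intros]:
  fixes f :: "'a::topological_space \<Rightarrow> real ^ 'n::finite"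
  assumes "continuous_on S f"
  shows "continuous_on S (\<lambda>y. z * f y)"
proof -
  have "bounded_linear (\<lambda>y. z * y :: real ^ 'n)"
    by (intro linear_conv_bounded_linear[THEN iffD1] linearI) (auto simp: vec_eq_iff algebra_simps)
  from bounded_linear.continuous_on[OF this assms] show ?thesis .
qed

lemma closed_relaxed_set: "closed (relaxed_set D z K)"
proof -
  have "relaxed_set D z K =
     {w. 0 \<le> fst (snd w)} \<inter> (\<Inter>m. {w. (lhs_mat D *v (z * snd (snd w))) $ m \<le> rhs_vec D $ m}) \<inter>
     {w. z \<bullet> snd (snd w) = 1} \<inter> (\<Inter>n. {w. 0 \<le> (z * snd (snd w)) $ n}) \<inter>
     (\<Inter>J\<in>K. {w. 0 \<le> 1 / (1 - conf_level D) *
        (tail_mass D J * fst w + tail_return D J \<bullet> (z * snd (snd w))) + fst (snd w)})"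
    by (auto simp: mem_relaxed_set tail_slack_def less_eq_vec_def)
  also have "closed \<dots>"
    by (intro closed_Int closed_INT ballI closed_Collect_le closed_Collect_eq continuous_intros
        matrix_vector_mult_linear_continuous_on[THEN continuous_on_compose2] ) auto
  finally show ?thesis .
qed

lemma abs_inner_portfolio_le:
  fixes q :: "real ^ 'n::finite"
  assumes "0 \<le> y" "1 \<bullet> y = 1"
  shows "\<bar>q \<bullet> y\<bar> \<le> norm q"
proof -
  have "norm y \<le> (\<Sum>n\<in>UNIV. \<bar>y $ n\<bar>)" by (rule norm_le_l1_cart)
  also have "\<dots> = 1 \<bullet> y" using assms by (simp add: inner_vec_def less_eq_vec_def)
  finally have "norm y \<le> 1" using assms by simp
  then show ?thesis
    using Cauchy_Schwarz_ineq2[of q y] mult_left_mono[of "norm y" 1 "norm q"] by simp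
qed

text \<open>These bounds make the objective coercive although \<open>a\<close> is a free variable. The cut for all scenarios bounds
\<open>a\<close> below by the expected loss minus \<open>(1 - \<beta>) * v\<close>, and the expected loss is bounded because a
portfolio lies in the simplex; what remains of \<open>a + v\<close> still grows like \<open>\<beta> * v\<close>.\<close>

lemma relaxed_set_bounds:
  fixes x :: "real ^ 'n::finite"
  assumes D: "valid_data D" and w: "(a, v, x) \<in> relaxed_set D z K" and "UNIV \<in> K"
  shows "conf_level D * v - norm (tail_return D UNIV) \<le> a + v"
    and "- norm (tail_return D UNIV) - v \<le> a"
proof -
  let ?\<beta> = "conf_level D" and ?B = "norm (tail_return D UNIV)"
  from D have \<beta>: "0 < ?\<beta>" "?\<beta> < 1" and mass: "tail_mass D UNIV = 1"
    by (auto simp: valid_data_def tail_mass_def)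
  from w have v: "0 \<le> v" and y: "0 \<le> z * x" "1 \<bullet> (z * x) = 1"
    by (auto simp: mem_relaxed_set inner_one_mult_vec)
  have "0 \<le> 1 / (1 - ?\<beta>) * (tail_mass D UNIV * a + tail_return D UNIV \<bullet> (z * x)) + v"
    using w \<open>UNIV \<in> K\<close> by (auto simp: mem_relaxed_set tail_slack_def)
  \<comment> \<open>The cut for all scenarios is cleared of its denominator; the total probability is one.\<close>
  then have "0 \<le> (1 - ?\<beta>) * (1 / (1 - ?\<beta>) * (a + tail_return D UNIV \<bullet> (z * x)) + v)"
    using \<beta> mass by (intro mult_nonneg_nonneg) auto
  then have "0 \<le> a + tail_return D UNIV \<bullet> (z * x) + (1 - ?\<beta>) * v"
    using \<beta> by (simp add: distrib_left)
  moreover have "\<bar>tail_return D UNIV \<bullet> (z * x)\<bar> \<le> ?B" by (rule abs_inner_portfolio_le[OF y])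
  moreover have "0 \<le> ?\<beta> * v" using \<beta> v by simp
  ultimately show "?\<beta> * v - ?B \<le> a + v" "- ?B - v \<le> a"
    by (auto simp: left_diff_distrib abs_le_iff)
qed

lemma relaxed_minimum_exists:
  fixes D :: "('n::finite, 'm::finite, 's::finite) portfolio_data"
  assumes D: "valid_data D" and "UNIV \<in> K" and ne: "relaxed_set D z K \<noteq> {}"
  shows "\<exists>a v x. is_arg_min (lower_objective D) (\<lambda>w. w \<in> relaxed_set D z K) (a, v, x)"
proof -
  let ?G = "relaxed_set D z K" and ?\<beta> = "conf_level D" and ?\<gamma> = "regularizer D"
  let ?B = "norm (tail_return D UNIV)"
  from D have pos: "0 < ?\<beta>" "0 < ?\<gamma>" by (auto simp: valid_data_def)
  obtain w0 where w0: "w0 \<in> ?G" using ne by blast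
  let ?c = "lower_objective D w0"
  \<comment> \<open>Only a sublevel set matters, and coercivity makes it compact.\<close>
  define C where "C = ?G \<inter> {w. lower_objective D w \<le> ?c}"
  have obj: "lower_objective D = (\<lambda>w. 1 / (2 * ?\<gamma>) * (snd (snd w) \<bullet> snd (snd w)) + fst w + fst (snd w))"
    by (auto simp: lower_objective_def fun_eq_iff)
  have cont: "continuous_on S (lower_objective D)" for S
    unfolding obj by (intro continuous_intros)
  have "closed C" unfolding C_def
    by (intro closed_Int closed_relaxed_set closed_Collect_le cont continuous_intros)
  moreover have "bounded C"
  proof -
    let ?V = "(?c + ?B) / ?\<beta>"
    let ?X = "sqrt (2 * ?\<gamma> * (?c + ?B))"
    have "C \<subseteq> {- ?B - ?V .. ?c} \<times> {0 .. ?V} \<times> cball 0 ?X"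
    proof (rule subsetI, unfold split_paired_all)
      fix a v x assume "(a, v, x) \<in> C"
      then have w: "(a, v, x) \<in> ?G" and le: "1 / (2 * ?\<gamma>) * (x \<bullet> x) + a + v \<le> ?c"
        by (auto simp: C_def lower_objective_def)
      note bd = relaxed_set_bounds[OF D w \<open>UNIV \<in> K\<close>]
      have v: "0 \<le> v" using w by (simp add: mem_relaxed_set)
      have sq: "0 \<le> 1 / (2 * ?\<gamma>) * (x \<bullet> x)" using pos by simp
      have \<beta>v: "0 \<le> ?\<beta> * v" using pos v by simp
      have "?\<beta> * v \<le> ?c + ?B" using bd(1) le sq by linarith
      then have vV: "v \<le> ?V" using pos by (simp add: field_simps)
      have "1 / (2 * ?\<gamma>) * (x \<bullet> x) \<le> ?c + ?B" using bd(1) le \<beta>v by linarith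
      then have "(norm x)\<^sup>2 \<le> 2 * ?\<gamma> * (?c + ?B)"
        using pos by (simp add: power2_norm_eq_inner field_simps)
      then have "norm x \<le> ?X" by (rule real_le_rsqrt)
      then show "(a, v, x) \<in> {- ?B - ?V .. ?c} \<times> {0 .. ?V} \<times> cball 0 ?X"
        using bd(2) le sq v vV by auto
    qed
    then show ?thesis
      by (rule bounded_subset[rotated]) (intro bounded_Times bounded_cball bounded_closed_interval)
  qed
  ultimately have "compact C" by (simp add: compact_eq_bounded_closed)
  moreover have "C \<noteq> {}" using w0 by (auto simp: C_def)
  ultimately obtain w where w: "w \<in> C" "\<And>u. u \<in> C \<Longrightarrow> lower_objective D w \<le> lower_objective D u"
    using continuous_attains_inf[OF _ _ cont] by metis
  have "is_arg_min (lower_objective D) (\<lambda>w. w \<in> ?G) w"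
    unfolding is_arg_min_linorder using w by (fastforce simp: C_def)
  then show ?thesis by (cases w) auto
qed

section \<open>Weak duality\<close>

lemma inner_vec_nonneg: "0 \<le> u \<Longrightarrow> 0 \<le> w \<Longrightarrow> 0 \<le> u \<bullet> (w :: real ^ 'n::finite)"
  by (simp add: inner_vec_def less_eq_vec_def sum_nonneg)

lemma mem_dual_feasible:
  "(\<alpha>, \<zeta>, l, \<omega>) \<in> dual_feasible D K \<longleftrightarrow>
     (1 / (1 - conf_level D)) *\<^sub>R (\<Sum>J\<in>K. \<alpha> J *\<^sub>R tail_return D J)
        - transpose (lhs_mat D) *v \<zeta> + l *\<^sub>R 1 \<le> \<omega> \<and>
     (\<Sum>J\<in>K. \<alpha> J) \<le> 1 \<and> (\<Sum>J\<in>K. \<alpha> J * tail_mass D J) = 1 - conf_level D \<and>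
     (\<forall>J\<in>K. 0 \<le> \<alpha> J) \<and> 0 \<le> \<zeta>"
  by (simp add: dual_feasible_def tail_return_def tail_mass_def)

text \<open>The dual feasible set does not depend on \<open>z\<close>, so a single dual point bounds the relaxations for all supports
at once; this makes the optimality cuts of the upper level valid. The bound is the usual Lagrangian
estimate: the cuts are added with weights \<open>\<alpha>\<close>, the portfolio constraints with weights \<open>\<zeta>\<close> and \<open>l\<close>,
and a square is completed in each coordinate of \<open>x\<close>.\<close>

lemma weak_duality:
  fixes D :: "('n::finite, 'm::finite, 's::finite) portfolio_data"
  assumes D: "valid_data D" and z: "z \<in> supports D"
    and w: "(a, v, x) \<in> relaxed_set D z K" and y: "(\<alpha>, \<zeta>, l, \<omega>) \<in> dual_feasible D K"
  shows "dual_objective D z (\<alpha>, \<zeta>, l, \<omega>) \<le> lower_objective D (a, v, x)"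
proof -
  let ?\<gamma> = "regularizer D"
  define c where "c = 1 / (1 - conf_level D)"
  define R where "R = (\<Sum>J\<in>K. \<alpha> J *\<^sub>R tail_return D J)"
  define u where "u = z * x"
  from D have \<gamma>: "0 < ?\<gamma>" and c: "c * (1 - conf_level D) = 1"
    by (auto simp: valid_data_def c_def)
  from w have v: "0 \<le> v" and Au: "lhs_mat D *v u \<le> rhs_vec D" and one: "1 \<bullet> u = 1" and u: "0 \<le> u"
    and cut: "\<And>J. J \<in> K \<Longrightarrow> 0 \<le> c * (tail_mass D J * a + tail_return D J \<bullet> u) + v"
    by (auto simp: mem_relaxed_set tail_slack_def u_def c_def inner_one_mult_vec)
  from y have \<omega>: "c *\<^sub>R R - transpose (lhs_mat D) *v \<zeta> + l *\<^sub>R 1 \<le> \<omega>"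
    and \<alpha>1: "(\<Sum>J\<in>K. \<alpha> J) \<le> 1" and mass: "(\<Sum>J\<in>K. \<alpha> J * tail_mass D J) = 1 - conf_level D"
    and \<alpha>0: "\<And>J. J \<in> K \<Longrightarrow> 0 \<le> \<alpha> J" and \<zeta>: "0 \<le> \<zeta>"
    by (auto simp: mem_dual_feasible R_def c_def)
  have "0 \<le> (\<Sum>J\<in>K. \<alpha> J * (c * (tail_mass D J * a + tail_return D J \<bullet> u) + v))"
    by (intro sum_nonneg mult_nonneg_nonneg \<alpha>0 cut)
  also have "\<dots> = c * (\<Sum>J\<in>K. \<alpha> J * tail_mass D J) * a + c * (R \<bullet> u) + (\<Sum>J\<in>K. \<alpha> J) * v"
    by (simp add: R_def algebra_simps sum.distrib inner_sum_left sum_distrib_left sum_distrib_right)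
  also have "\<dots> = a + c * (R \<bullet> u) + (\<Sum>J\<in>K. \<alpha> J) * v"
    using c mass by simp
  also have "\<dots> \<le> a + c * (R \<bullet> u) + v"
    using mult_right_mono[OF \<alpha>1 v] by simp
  finally have tail: "0 \<le> a + c * (R \<bullet> u) + v" .
  have "0 \<le> (\<omega> - (c *\<^sub>R R - transpose (lhs_mat D) *v \<zeta> + l *\<^sub>R 1)) \<bullet> u"
    using \<omega> u by (intro inner_vec_nonneg) (simp_all add: less_eq_vec_def)
  then have "c * (R \<bullet> u) - \<zeta> \<bullet> (lhs_mat D *v u) + l \<le> \<omega> \<bullet> u"
    using one by (simp add: inner_diff_left inner_add_left dot_lmul_matrix)
  moreover have "0 \<le> \<zeta> \<bullet> (rhs_vec D - lhs_mat D *v u)"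
    using Au \<zeta> by (intro inner_vec_nonneg) (simp_all add: less_eq_vec_def)
  then have "\<zeta> \<bullet> (lhs_mat D *v u) \<le> rhs_vec D \<bullet> \<zeta>"
    by (simp add: inner_diff_right inner_commute)
  moreover have "\<omega> \<bullet> u \<le> 1 / (2 * ?\<gamma>) * (x \<bullet> x) + ?\<gamma> / 2 * (z \<bullet> (\<omega> * \<omega>))"
  proof -
    have "\<omega> $ n * (z $ n * x $ n)
        \<le> 1 / (2 * ?\<gamma>) * (x $ n * x $ n) + ?\<gamma> / 2 * (z $ n * (\<omega> $ n * \<omega> $ n))" for n
    proof -
      \<comment> \<open>Completing the square; for a binary coordinate, its square is the coordinate itself.\<close>
      have "0 \<le> 1 / (2 * ?\<gamma>) * (x $ n - ?\<gamma> * (z $ n * \<omega> $ n))\<^sup>2" using \<gamma> by simp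
      also have "\<dots> = 1 / (2 * ?\<gamma>) * (x $ n * x $ n) - \<omega> $ n * (z $ n * x $ n)
          + ?\<gamma> / 2 * ((z $ n * z $ n) * (\<omega> $ n * \<omega> $ n))"
        using \<gamma> by (simp add: power2_eq_square field_simps)
      finally show ?thesis using supports_binary[OF z, of n] by auto
    qed
    then show ?thesis
      by (simp add: inner_vec_def u_def sum_distrib_left flip: sum.distrib) (rule sum_mono, simp)
  qed
  ultimately show ?thesis using tail
    by (simp add: dual_objective_def lower_objective_def)
qed

section \<open>First-order optimality over the homogenised relaxation\<close>

lemma tail_slack_add:
  "tail_slack D z J (a + a') (v + v') (x + x') = tail_slack D z J a v x + tail_slack D z J a' v' x'"
proof -
  have "c * (P * (a + a') + R \<bullet> (z * (x + x'))) + (v + v')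
      = c * (P * a + R \<bullet> (z * x)) + v + (c * (P * a' + R \<bullet> (z * x')) + v')" for c P R
    by (simp add: algebra_simps inner_add_right)
  then show ?thesis by (simp only: tail_slack_def)
qed

lemma tail_slack_scale:
  "tail_slack D z J (r * a) (r * v) (r *\<^sub>R x) = r * tail_slack D z J a v x"
proof -
  have zx: "z * (r *\<^sub>R x) = r *\<^sub>R (z * x)" by (simp add: vec_eq_iff)
  have "c * (P * (r * a) + R \<bullet> (z * (r *\<^sub>R x))) + r * v = r * (c * (P * a + R \<bullet> (z * x)) + v)" for c P R
    by (simp add: algebra_simps zx)
  then show ?thesis by (simp only: tail_slack_def)
qed

text \<open>The cone over the relaxation, with \<open>t\<close> as its homogenising coordinate: level one is the relaxation and
level zero contains its recession directions. Treating both in one family avoids a case distinction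
between them in the theorem of the alternative.\<close>

definition relaxed_cone ::
  "('n::finite, 'm::finite, 's::finite) portfolio_data \<Rightarrow> real ^ 'n \<Rightarrow> 's set set \<Rightarrow> real
     \<Rightarrow> (real \<times> real \<times> (real ^ 'n)) set" where
  "relaxed_cone D z K t = {(a, v, x).
     0 \<le> v \<and> lhs_mat D *v (z * x) \<le> t *\<^sub>R rhs_vec D \<and> z \<bullet> x = t \<and> 0 \<le> z * x \<and>
     (\<forall>J\<in>K. 0 \<le> tail_slack D z J a v x)}"

lemma relaxed_cone_1: "relaxed_cone D z K 1 = relaxed_set D z K"
  by (auto simp: relaxed_cone_def mem_relaxed_set)

lemma relaxed_cone_add:
  assumes "w \<in> relaxed_cone D z K s" "w' \<in> relaxed_cone D z K t"
  shows "w + w' \<in> relaxed_cone D z K (s + t)"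
proof -
  obtain a v x a' v' x' where w: "w = (a, v, x)" "w' = (a', v', x')" by (metis surj_pair)
  have "lhs_mat D *v (z * (x + x')) \<le> (s + t) *\<^sub>R rhs_vec D"
    using assms unfolding w relaxed_cone_def
    by (auto simp: distrib_left matrix_vector_right_distrib scaleR_add_left intro!: add_mono)
  then show ?thesis
    using assms unfolding w relaxed_cone_def
    by (auto simp: distrib_left inner_add_right tail_slack_add)
qed

lemma relaxed_cone_scale:
  assumes "w \<in> relaxed_cone D z K t" "0 \<le> r"
  shows "r *\<^sub>R w \<in> relaxed_cone D z K (r * t)"
proof -
  obtain a v x where w: "w = (a, v, x)" by (metis surj_pair)
  have zx: "z * (r *\<^sub>R x) = r *\<^sub>R (z * x)" by (simp add: vec_eq_iff)
  have "lhs_mat D *v (r *\<^sub>R (z * x)) \<le> (r * t) *\<^sub>R rhs_vec D"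
    using assms unfolding w relaxed_cone_def
    by (auto simp: matrix_vector_mult_scaleR less_eq_vec_def mult.assoc intro!: mult_left_mono)
  moreover have "0 \<le> r *\<^sub>R (z * x)"
    using assms unfolding w relaxed_cone_def by (auto simp: less_eq_vec_def)
  ultimately show ?thesis
    using assms unfolding w relaxed_cone_def by (auto simp: zx tail_slack_scale)
qed

lemma linear_coefficient_nonneg:
  fixes d q :: real
  assumes "\<And>r. 0 < r \<Longrightarrow> r \<le> 1 \<Longrightarrow> 0 \<le> r * d + r\<^sup>2 * q"
  shows "0 \<le> d"
proof (rule ccontr)
  assume "\<not> 0 \<le> d"
  then have d: "d < 0" by simp
  from assms[of 1] have dq: "- d \<le> q" by simp
  with d have q: "0 < q" by simp
  \<comment> \<open>The quadratic is smallest at this parameter.\<close>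
  let ?r = "- d / (2 * q)"
  have "0 \<le> ?r * d + ?r\<^sup>2 * q"
    using d dq q by (intro assms) (simp_all add: field_simps)
  also have "\<dots> = - (d\<^sup>2 / (4 * q))"
    using q by (simp add: field_simps power2_eq_square)
  finally show False using d q by (simp add: divide_le_0_iff)
qed

text \<open>The first-order optimality condition of the quadratic problem, in homogeneous form. The gradient of the
objective at the minimiser is \<open>(1, 1, x / \<gamma>)\<close>, and adding a cone element of level \<open>t\<close> to the minimiser and
rescaling by \<open>1 / (1 + t)\<close> leads back into the relaxation, so that the minimiser can be compared with
the points of the segment towards it.\<close>

lemma optimality_along_cone:
  fixes D :: "('n::finite, 'm::finite, 's::finite) portfolio_data"
  assumes D: "valid_data D"
    and opt: "is_arg_min (lower_objective D) (\<lambda>w. w \<in> relaxed_set D z K) (a, v, x)"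
    and h: "(ha, hv, hx) \<in> relaxed_cone D z K t" and t: "0 \<le> t"
  shows "t * (a + v + (x \<bullet> x) / regularizer D) \<le> ha + hv + (x \<bullet> hx) / regularizer D"
proof -
  let ?\<gamma> = "regularizer D"
  let ?s = "1 / (1 + t)"
  from D have \<gamma>: "0 < ?\<gamma>" by (simp add: valid_data_def)
  have w: "(a, v, x) \<in> relaxed_cone D z K 1" using opt by (simp add: is_arg_min_def relaxed_cone_1)
  define d where "d = ha + hv + (x \<bullet> hx) / ?\<gamma> - t * (a + v + (x \<bullet> x) / ?\<gamma>)"
  define e where "e = hx - t *\<^sub>R x"
  have "0 \<le> d"
  proof (rule linear_coefficient_nonneg)
    fix r :: real assume r: "0 < r" "r \<le> 1"
    define s where "s = r / (1 + t)"
    have s: "0 \<le> s" "s * t \<le> 1"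
      using r t by (auto simp: s_def field_simps intro: order_trans[OF mult_right_mono[of r 1]])
    \<comment> \<open>The point at parameter \<open>r\<close> of that segment is itself a combination in the cone.\<close>
    have "(1 - s * t) *\<^sub>R (a, v, x) + s *\<^sub>R (ha, hv, hx) \<in> relaxed_cone D z K ((1 - s * t) * 1 + s * t)"
      using s by (intro relaxed_cone_add relaxed_cone_scale w h) auto
    then have "(a + s * (ha - t * a), v + s * (hv - t * v), x + s *\<^sub>R e) \<in> relaxed_set D z K"
      by (simp add: relaxed_cone_1 e_def algebra_simps)
    then have "lower_objective D (a, v, x)
        \<le> lower_objective D (a + s * (ha - t * a), v + s * (hv - t * v), x + s *\<^sub>R e)"
      using opt by (simp add: is_arg_min_linorder)
    moreover have "lower_objective D (a + s * (ha - t * a), v + s * (hv - t * v), x + s *\<^sub>R e)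
        = lower_objective D (a, v, x) + (s * d + s\<^sup>2 * ((e \<bullet> e) / (2 * ?\<gamma>)))"
    proof -
      define g where "g = 1 / (2 * ?\<gamma>)"
      have g: "y / ?\<gamma> = 2 * g * y" "y / (2 * ?\<gamma>) = g * y" for y
        by (simp_all add: g_def)
      have hx: "hx = e + t *\<^sub>R x" by (simp add: e_def)
      show ?thesis
        unfolding lower_objective_def d_def g(1) g(2) g_def[symmetric] hx
        by (simp add: algebra_simps power2_eq_square inner_add_left inner_add_right inner_commute)
    qed
    ultimately have "0 \<le> s * d + s\<^sup>2 * ((e \<bullet> e) / (2 * ?\<gamma>))" by simp
    then have "0 \<le> (1 + t) * (s * d + s\<^sup>2 * ((e \<bullet> e) / (2 * ?\<gamma>)))"
      using t by simp
    also have "\<dots> = r * d + r\<^sup>2 * ((e \<bullet> e) / (2 * ?\<gamma>) / (1 + t))"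
      using t \<gamma> by (simp add: s_def divide_simps) (simp add: algebra_simps power2_eq_square)
    finally show "0 \<le> r * d + r\<^sup>2 * ((e \<bullet> e) / (2 * ?\<gamma>) / (1 + t))" .
  qed
  then show ?thesis by (simp add: d_def)
qed

section \<open>Strong duality\<close>

text \<open>The coefficients of \<open>a\<close>, \<open>v\<close>, \<open>x\<close> and the constant in the inequality obtained by adding all constraints of
the relaxation with the given weights: \<open>\<alpha>\<close> for the cuts, \<open>\<mu>\<close> for \<open>0 \<le> v\<close>, \<open>\<zeta>\<close> for the inequalities
given by the matrix, \<open>l\<close> for the budget equation, \<open>\<eta>\<close> for nonnegativity of the portfolio. The weight
\<open>\<kappa>\<close> lowers the constant.\<close>

definition multiplier_combination ::
  "('n::finite, 'm::finite, 's::finite) portfolio_data \<Rightarrow> real ^ 'n \<Rightarrow> 's set set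
     \<Rightarrow> ('s set \<Rightarrow> real) \<Rightarrow> real \<Rightarrow> real ^ 'm \<Rightarrow> real \<Rightarrow> real ^ 'n \<Rightarrow> real
     \<Rightarrow> real \<times> real \<times> (real ^ 'n) \<times> real" where
  "multiplier_combination D z K \<alpha> \<mu> \<zeta> l \<eta> \<kappa> =
     (1 / (1 - conf_level D) * (\<Sum>J\<in>K. \<alpha> J * tail_mass D J),
      (\<Sum>J\<in>K. \<alpha> J) + \<mu>,
      z * ((1 / (1 - conf_level D)) *\<^sub>R (\<Sum>J\<in>K. \<alpha> J *\<^sub>R tail_return D J)
             - transpose (lhs_mat D) *v \<zeta> + l *\<^sub>R 1 + \<eta>),
      l - rhs_vec D \<bullet> \<zeta> - \<kappa>)"

lemma multiplier_combination_pairing: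
  "(ha, hv, hx, - t) \<bullet> multiplier_combination D z K \<alpha> \<mu> \<zeta> l \<eta> \<kappa> =
     (\<Sum>J\<in>K. \<alpha> J * tail_slack D z J ha hv hx) + \<mu> * hv
     + \<zeta> \<bullet> (t *\<^sub>R rhs_vec D - lhs_mat D *v (z * hx)) + l * (z \<bullet> hx - t) + \<eta> \<bullet> (z * hx) + \<kappa> * t"
proof -
  have comm: "hx \<bullet> (z * y) = y \<bullet> (z * hx)" for y by (simp add: inner_vec_def mult_ac)
  have slack: "(\<Sum>J\<in>K. \<alpha> J * (c * (tail_mass D J * ha + tail_return D J \<bullet> u) + hv))
      = ha * (c * (\<Sum>J\<in>K. \<alpha> J * tail_mass D J)) + hv * (\<Sum>J\<in>K. \<alpha> J)
        + (c *\<^sub>R (\<Sum>J\<in>K. \<alpha> J *\<^sub>R tail_return D J)) \<bullet> u" for c u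
    by (simp add: algebra_simps sum.distrib inner_sum_left sum_distrib_left sum_distrib_right)
  have adj: "u \<bullet> (\<zeta> v* lhs_mat D) = \<zeta> \<bullet> (lhs_mat D *v u)" for u
    by (simp add: dot_lmul_matrix inner_commute[of u])
  show ?thesis
    unfolding multiplier_combination_def inner_prod_def fst_conv snd_conv comm tail_slack_def slack
    by (simp add: adj algebra_simps inner_add_left inner_diff_left inner_diff_right dot_lmul_matrix
        inner_one_mult_vec inner_commute)
qed

definition multiplier_cone ::
  "('n::finite, 'm::finite, 's::finite) portfolio_data \<Rightarrow> real ^ 'n \<Rightarrow> 's set set
     \<Rightarrow> (real \<times> real \<times> (real ^ 'n) \<times> real) set" where
  "multiplier_cone D z K =
     {multiplier_combination D z K \<alpha> \<mu> \<zeta> l \<eta> \<kappa> | \<alpha> \<mu> \<zeta> l \<eta> \<kappa>.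
        (\<forall>J\<in>K. 0 \<le> \<alpha> J) \<and> 0 \<le> \<mu> \<and> 0 \<le> \<zeta> \<and> 0 \<le> \<eta> \<and> 0 \<le> \<kappa>}"

lemma multiplier_coneI:
  "\<lbrakk>\<And>J. J \<in> K \<Longrightarrow> 0 \<le> \<alpha> J; 0 \<le> \<mu>; 0 \<le> \<zeta>; 0 \<le> \<eta>; 0 \<le> \<kappa>\<rbrakk>
     \<Longrightarrow> multiplier_combination D z K \<alpha> \<mu> \<zeta> l \<eta> \<kappa> \<in> multiplier_cone D z K"
  unfolding multiplier_cone_def by blast

text \<open>Hence it contains the convex cone generated by any finite set of its elements, which is closed and can
be separated from points outside.\<close>

lemma convex_cone_multiplier_cone: "convex_cone (multiplier_cone D z K)"
proof -
  have add: "multiplier_combination D z K \<alpha> \<mu> \<zeta> l \<eta> \<kappa> + multiplier_combination D z K \<alpha>' \<mu>' \<zeta>' l' \<eta>' \<kappa>'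
      = multiplier_combination D z K (\<lambda>J. \<alpha> J + \<alpha>' J) (\<mu> + \<mu>') (\<zeta> + \<zeta>') (l + l') (\<eta> + \<eta>') (\<kappa> + \<kappa>')"
    for \<alpha> \<mu> \<zeta> l \<eta> \<kappa> \<alpha>' \<mu>' \<zeta>' l' \<eta>' \<kappa>'
    by (simp add: multiplier_combination_def algebra_simps sum.distrib add_divide_distrib
        vector_matrix_left_distrib inner_add_right)
  have scale: "r *\<^sub>R multiplier_combination D z K \<alpha> \<mu> \<zeta> l \<eta> \<kappa>
      = multiplier_combination D z K (\<lambda>J. r * \<alpha> J) (r * \<mu>) (r *\<^sub>R \<zeta>) (r * l) (r *\<^sub>R \<eta>) (r * \<kappa>)"
    for r \<alpha> \<mu> \<zeta> l \<eta> \<kappa>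
  proof -
    have sums: "(\<Sum>J\<in>K. r * \<alpha> J * f J) = r * (\<Sum>J\<in>K. \<alpha> J * f J)" "(\<Sum>J\<in>K. r * \<alpha> J) = r * (\<Sum>J\<in>K. \<alpha> J)"
      "(\<Sum>J\<in>K. (r * \<alpha> J) *\<^sub>R g J) = r *\<^sub>R (\<Sum>J\<in>K. \<alpha> J *\<^sub>R g J)" for f :: "_ \<Rightarrow> real" and g :: "_ \<Rightarrow> real ^ 'a"
      by (simp_all add: sum_distrib_left scaleR_sum_right mult.assoc)
    have vec: "r *\<^sub>R (z * (c *\<^sub>R R - y + l *\<^sub>R 1 + \<eta>))
        = z * (c *\<^sub>R r *\<^sub>R R - r *\<^sub>R y + (r * l) *\<^sub>R 1 + r *\<^sub>R \<eta>)" for c R y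
      by (simp add: vec_eq_iff algebra_simps)
    show ?thesis
      unfolding multiplier_combination_def scaleR_Pair sums vec matrix_vector_mult_scaleR
      by (simp add: algebra_simps)
  qed
  have zero: "0 \<in> multiplier_cone D z K"
  proof -
    have "0 = multiplier_combination D z K (\<lambda>_. 0) 0 0 0 0 0"
      by (simp add: multiplier_combination_def zero_prod_def)
    moreover have "\<dots> \<in> multiplier_cone D z K" by (rule multiplier_coneI) simp_all
    ultimately show ?thesis by metis
  qed
  show ?thesis unfolding convex_cone_iff
  proof (intro conjI ballI allI impI zero)
    fix p q assume "p \<in> multiplier_cone D z K" "q \<in> multiplier_cone D z K"
    then obtain \<alpha> \<mu> \<zeta> l \<eta> \<kappa> \<alpha>' \<mu>' \<zeta>' l' \<eta>' \<kappa>'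
      where "p = multiplier_combination D z K \<alpha> \<mu> \<zeta> l \<eta> \<kappa>" "q = multiplier_combination D z K \<alpha>' \<mu>' \<zeta>' l' \<eta>' \<kappa>'"
        "\<forall>J\<in>K. 0 \<le> \<alpha> J" "0 \<le> \<mu>" "0 \<le> \<zeta>" "0 \<le> \<eta>" "0 \<le> \<kappa>"
        "\<forall>J\<in>K. 0 \<le> \<alpha>' J" "0 \<le> \<mu>'" "0 \<le> \<zeta>'" "0 \<le> \<eta>'" "0 \<le> \<kappa>'"
      unfolding multiplier_cone_def by blast
    then show "p + q \<in> multiplier_cone D z K"
      by (simp only: add, intro multiplier_coneI) (simp_all add: add_nonneg_nonneg)
  next
    fix p and r :: real assume "p \<in> multiplier_cone D z K" and r: "0 \<le> r"
    then obtain \<alpha> \<mu> \<zeta> l \<eta> \<kappa>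
      where "p = multiplier_combination D z K \<alpha> \<mu> \<zeta> l \<eta> \<kappa>"
        "\<forall>J\<in>K. 0 \<le> \<alpha> J" "0 \<le> \<mu>" "0 \<le> \<zeta>" "0 \<le> \<eta>" "0 \<le> \<kappa>"
      unfolding multiplier_cone_def by blast
    then show "r *\<^sub>R p \<in> multiplier_cone D z K"
      using r by (simp only: scale, intro multiplier_coneI) (simp_all add: less_eq_vec_def)
  qed
qed

text \<open>Farkas' lemma for the relaxation. A closed finitely generated cone is separated from any point outside
by a linear functional, and nonnegativity of this functional on the generators says, generator by
generator, that it is an element of the cone over the relaxation.\<close>

lemma multiplier_cone_separation:
  fixes D :: "('n::finite, 'm::finite, 's::finite) portfolio_data"
  assumes "p \<notin> multiplier_cone D z K"
  obtains t ha hv hx where "0 \<le> t" "(ha, hv, hx) \<in> relaxed_cone D z K t" "(ha, hv, hx, - t) \<bullet> p < 0"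
proof -
  let ?mc = "multiplier_combination D z K"
  \<comment> \<open>One generator for each weight; the weight of the budget equation has free sign and takes two.\<close>
  define gens where "gens =
      (\<lambda>J. ?mc (\<lambda>J'. of_bool (J' = J)) 0 0 0 0 0) ` K
      \<union> range (\<lambda>m. ?mc (\<lambda>_. 0) 0 (axis m 1) 0 0 0) \<union> range (\<lambda>n. ?mc (\<lambda>_. 0) 0 0 0 (axis n 1) 0)
      \<union> {?mc (\<lambda>_. 0) 1 0 0 0 0, ?mc (\<lambda>_. 0) 0 0 1 0 0, ?mc (\<lambda>_. 0) 0 0 (- 1) 0 0, ?mc (\<lambda>_. 0) 0 0 0 0 1}"
  let ?C = "convex_cone hull gens"
  have ax: "0 \<le> axis i (1 :: real)" for i :: "'i::finite" by (simp add: less_eq_vec_def axis_def)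
  have "gens \<subseteq> multiplier_cone D z K"
    unfolding gens_def by (auto intro!: multiplier_coneI ax)
  then have "?C \<subseteq> multiplier_cone D z K"
    by (rule hull_minimal[of _ _ convex_cone]) (rule convex_cone_multiplier_cone)
  then have p: "p \<notin> ?C" using assms by blast
  have "closed ?C" by (rule closed_convex_cone_hull) (simp add: gens_def)
  then obtain h b where hp: "h \<bullet> p < b" and hC: "\<And>q. q \<in> ?C \<Longrightarrow> b < h \<bullet> q"
    using separating_hyperplane_closed_point[OF convex_convex_cone_hull _ p] by blast
  have b: "b < 0" using hC[OF convex_cone_hull_contains_0] by simp
  have hg: "0 \<le> h \<bullet> q" if "q \<in> gens" for q
  proof (rule ccontr)
    assume neg: "\<not> 0 \<le> h \<bullet> q"
    \<comment> \<open>A generator with negative value could be scaled until it reaches the separating bound.\<close>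
    have "(b / (h \<bullet> q)) *\<^sub>R q \<in> ?C"
      using b neg hull_inc[OF that] by (intro convex_cone_hull_mul) (auto intro: divide_nonpos_nonpos)
    from hC[OF this] neg show False by simp
  qed
  obtain ha hv hx s where h: "h = (ha, hv, hx, s)" by (metis surj_pair)
  \<comment> \<open>The last coordinate pairs with the constant of an inequality, hence the sign.\<close>
  define t where "t = - s"
  have h: "h = (ha, hv, hx, - t)" using h by (simp add: t_def)
  note pair = multiplier_combination_pairing[of ha hv hx t D z K]
  have gens:
    "?mc (\<lambda>_. 0) 1 0 0 0 0 \<in> gens" "?mc (\<lambda>_. 0) 0 0 1 0 0 \<in> gens"
    "?mc (\<lambda>_. 0) 0 0 (- 1) 0 0 \<in> gens" "?mc (\<lambda>_. 0) 0 0 0 0 1 \<in> gens"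
    "?mc (\<lambda>_. 0) 0 (axis m 1) 0 0 0 \<in> gens" "?mc (\<lambda>_. 0) 0 0 0 (axis n 1) 0 \<in> gens" for m n
    unfolding gens_def by blast+
  have gens_K: "?mc (\<lambda>J'. of_bool (J' = J)) 0 0 0 0 0 \<in> gens" if "J \<in> K" for J
    unfolding gens_def using that by blast
  have t: "0 \<le> t" using hg[of "?mc (\<lambda>_. 0) 0 0 0 0 1"] gens by (simp add: h pair)
  have v: "0 \<le> hv" using hg[of "?mc (\<lambda>_. 0) 1 0 0 0 0"] gens by (simp add: h pair)
  have "0 \<le> z \<bullet> hx - t" using hg[of "?mc (\<lambda>_. 0) 0 0 1 0 0"] gens by (simp add: h pair)
  moreover have "z \<bullet> hx - t \<le> 0" using hg[of "?mc (\<lambda>_. 0) 0 0 (- 1) 0 0"] gens by (simp add: h pair)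
  ultimately have zt: "z \<bullet> hx = t" by simp
  have "0 \<le> (z * hx) $ n" for n
    using hg[of "?mc (\<lambda>_. 0) 0 0 0 (axis n 1) 0"] gens by (simp add: h pair inner_axis')
  then have zx: "0 \<le> z * hx" by (simp add: less_eq_vec_def)
  have "(lhs_mat D *v (z * hx)) $ m \<le> (t *\<^sub>R rhs_vec D) $ m" for m
    using hg[of "?mc (\<lambda>_. 0) 0 (axis m 1) 0 0 0"] gens by (simp add: h pair inner_axis')
  then have Ax: "lhs_mat D *v (z * hx) \<le> t *\<^sub>R rhs_vec D" by (simp add: less_eq_vec_def)
  have "0 \<le> tail_slack D z J ha hv hx" if "J \<in> K" for J
    using hg[of "?mc (\<lambda>J'. of_bool (J' = J)) 0 0 0 0 0"] gens_K[OF that] that by (simp add: h pair of_bool_def if_distrib[of "\<lambda>c. c * _"] cong: if_cong)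
  then have "(ha, hv, hx) \<in> relaxed_cone D z K t"
    using v zt zx Ax by (simp add: relaxed_cone_def)
  moreover have "(ha, hv, hx, - t) \<bullet> p < 0" using hp b h by simp
  ultimately show ?thesis using that t by blast
qed

text \<open>Strong duality, together with attainment in the dual. By the optimality condition, the gradient at the
minimiser, with the value of this linear functional there as constant, cannot be separated from the
multiplier cone, so it is a combination of the constraints. The weights give a dual point, with \<open>\<omega>\<close> chosen such that stationarity in \<open>x\<close>
reads \<open>x / \<gamma> = z * \<omega>\<close>; hence the quadratic terms of the two objectives match.\<close>

lemma dual_certificate:
  fixes D :: "('n::finite, 'm::finite, 's::finite) portfolio_data"
  assumes D: "valid_data D" and z: "z \<in> supports D"
    and opt: "is_arg_min (lower_objective D) (\<lambda>w. w \<in> relaxed_set D z K) w"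
  obtains y where "y \<in> dual_feasible D K" "lower_objective D w \<le> dual_objective D z y"
proof -
  obtain a v x where w: "w = (a, v, x)" by (metis surj_pair)
  let ?\<gamma> = "regularizer D" and ?c = "1 / (1 - conf_level D)"
  define c0 where "c0 = a + v + (x \<bullet> x) / ?\<gamma>"
  from D have \<gamma>: "0 < ?\<gamma>" and c: "conf_level D < 1" by (auto simp: valid_data_def)
  have "(1, 1, x /\<^sub>R ?\<gamma>, c0) \<in> multiplier_cone D z K"
  proof (rule ccontr)
    assume "(1, 1, x /\<^sub>R ?\<gamma>, c0) \<notin> multiplier_cone D z K"
    then obtain t ha hv hx where t: "0 \<le> t" and h: "(ha, hv, hx) \<in> relaxed_cone D z K t"
      and neg: "(ha, hv, hx, - t) \<bullet> (1, 1, x /\<^sub>R ?\<gamma>, c0) < 0"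
      by (rule multiplier_cone_separation)
    from neg have "ha + hv + (x \<bullet> hx) / ?\<gamma> < t * c0"
      by (simp add: inner_prod_def inner_commute divide_inverse mult.commute)
    with optimality_along_cone[OF D opt[unfolded w] h t] show False by (simp add: c0_def)
  qed
  then obtain \<alpha> \<mu> \<zeta> l \<eta> \<kappa> where nonneg: "\<forall>J\<in>K. 0 \<le> \<alpha> J" "0 \<le> \<mu>" "0 \<le> \<zeta>" "0 \<le> \<eta>" "0 \<le> \<kappa>"
    and eq: "(1, 1, x /\<^sub>R ?\<gamma>, c0) = multiplier_combination D z K \<alpha> \<mu> \<zeta> l \<eta> \<kappa>"
    unfolding multiplier_cone_def by blast
  define \<omega> where "\<omega> = ?c *\<^sub>R (\<Sum>J\<in>K. \<alpha> J *\<^sub>R tail_return D J) - transpose (lhs_mat D) *v \<zeta> + l *\<^sub>R 1 + \<eta>"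
  from eq have mass: "1 = ?c * (\<Sum>J\<in>K. \<alpha> J * tail_mass D J)" and budget: "1 = (\<Sum>J\<in>K. \<alpha> J) + \<mu>"
    and stat: "x /\<^sub>R ?\<gamma> = z * \<omega>" and const: "c0 = l - rhs_vec D \<bullet> \<zeta> - \<kappa>"
    unfolding multiplier_combination_def \<omega>_def prod.inject by auto
  have feas: "(\<alpha>, \<zeta>, l, \<omega>) \<in> dual_feasible D K"
    unfolding mem_dual_feasible
    using nonneg budget mass c by (auto simp: \<omega>_def field_simps)
  have "z \<bullet> (\<omega> * \<omega>) = (x \<bullet> x) / ?\<gamma>\<^sup>2"
  proof -
    have "z $ n * (\<omega> $ n * \<omega> $ n) = (z * \<omega>) $ n * (z * \<omega>) $ n" for n
      using supports_binary[OF z, of n] by auto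
    then have "z \<bullet> (\<omega> * \<omega>) = (z * \<omega>) \<bullet> (z * \<omega>)"
      by (simp only: inner_vec_def inner_real_def vector_mult_component[of \<omega> \<omega>])
    then show ?thesis using \<gamma> by (simp flip: stat) (simp add: field_simps power2_eq_square)
  qed
  then have "?\<gamma> / 2 * (z \<bullet> (\<omega> * \<omega>)) = 1 / (2 * ?\<gamma>) * (x \<bullet> x)"
    using \<gamma> by (simp add: power2_eq_square)
  moreover have "(x \<bullet> x) / ?\<gamma> = 2 * (1 / (2 * ?\<gamma>) * (x \<bullet> x))" by simp
  ultimately have "lower_objective D w \<le> dual_objective D z (\<alpha>, \<zeta>, l, \<omega>)"
    using const nonneg(5) unfolding w lower_objective_def dual_objective_def c0_def prod.case
    by linarith
  with feas show ?thesis by (rule that)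
qed

section \<open>Cuts from dual optima\<close>

text \<open>The lower-level algorithm returns the minimum for a family \<open>K\<close>, but reports this family extended by the last
tail \<open>J\<close>. The additional cut can only raise the minimum, so that the dual optimum for the larger family is
still an upper bound.\<close>

lemma relaxed_minimum_le_dual_optimum:
  fixes D :: "('n::finite, 'm::finite, 's::finite) portfolio_data"
  assumes D: "valid_data D" and z: "z \<in> supports D" and ne: "lower_initial_set D z \<noteq> {}"
    and "UNIV \<in> K" and opt: "is_arg_min (lower_objective D) (\<lambda>w. w \<in> relaxed_set D z K) w"
    and y: "dual_optimal D (insert J K) z y"
  shows "lower_objective D w \<le> dual_objective D z y"
proof -
  obtain w' where w': "is_arg_min (lower_objective D) (\<lambda>w. w \<in> relaxed_set D z (insert J K)) w'"
    using relaxed_minimum_exists[OF D _ relaxed_set_nonempty[OF D ne]] \<open>UNIV \<in> K\<close> by blast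
  then have "lower_objective D w \<le> lower_objective D w'"
    using opt unfolding is_arg_min_linorder relaxed_set_insert by blast
  also obtain y' where y': "y' \<in> dual_feasible D (insert J K)"
      "lower_objective D w' \<le> dual_objective D z y'"
    by (rule dual_certificate[OF D z w'])
  note y'(2)
  also have "dual_objective D z y' \<le> dual_objective D z y"
    using y y'(1) unfolding dual_optimal_def is_arg_max_linorder by blast
  finally show ?thesis .
qed

lemma dual_optimum_exists:
  fixes D :: "('n::finite, 'm::finite, 's::finite) portfolio_data"
  assumes D: "valid_data D" and z: "z \<in> supports D" and ne: "lower_initial_set D z \<noteq> {}"
    and "UNIV \<in> K"
  shows "\<exists>\<alpha> \<zeta> l \<omega>. dual_optimal D K z (\<alpha>, \<zeta>, l, \<omega>)"
proof -
  obtain a v x where w: "is_arg_min (lower_objective D) (\<lambda>w. w \<in> relaxed_set D z K) (a, v, x)"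
    using relaxed_minimum_exists[OF D \<open>UNIV \<in> K\<close> relaxed_set_nonempty[OF D ne]] by blast
  obtain y where y: "y \<in> dual_feasible D K"
      "lower_objective D (a, v, x) \<le> dual_objective D z y"
    by (rule dual_certificate[OF D z w])
  have "(a, v, x) \<in> relaxed_set D z K" using w by (simp add: is_arg_min_def)
  then have "dual_objective D z y' \<le> dual_objective D z y" if "y' \<in> dual_feasible D K" for y'
    using weak_duality[OF D z] that y(2) by (cases y') (blast intro: order_trans)
  then have "dual_optimal D K z y"
    using y(1) unfolding dual_optimal_def is_arg_max_linorder by blast
  then show ?thesis by (cases y) auto
qed

text \<open>The dual objective is affine in \<open>z\<close> with slope \<open>- \<gamma> / 2 * (\<omega> * \<omega>)\<close>, so weak duality at \<open>z'\<close> gives the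
cut, in which \<open>f\<close> stands for any lower estimate of the dual value at \<open>z\<close>.\<close>

lemma optimality_cut_valid:
  fixes D :: "('n::finite, 'm::finite, 's::finite) portfolio_data"
  assumes D: "valid_data D" and z': "z' \<in> supports D" and y: "(\<alpha>, \<zeta>, l, \<omega>) \<in> dual_feasible D K"
    and f: "f \<le> dual_objective D z (\<alpha>, \<zeta>, l, \<omega>)"
  shows "ereal (f + (- (regularizer D / 2) *\<^sub>R (\<omega> * \<omega>)) \<bullet> (z' - z)) \<le> lower_value D z'"
  unfolding lower_value_def
proof (rule INF_greatest)
  fix w assume "w \<in> lower_feasible D z'"
  then have w: "w \<in> relaxed_set D z' K" using lower_feasible_subset_relaxed[OF D] by blast
  have "f + (- (regularizer D / 2) *\<^sub>R (\<omega> * \<omega>)) \<bullet> (z' - z)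
      \<le> dual_objective D z (\<alpha>, \<zeta>, l, \<omega>) + (- (regularizer D / 2) *\<^sub>R (\<omega> * \<omega>)) \<bullet> (z' - z)"
    using f by simp
  also have "\<dots> = dual_objective D z' (\<alpha>, \<zeta>, l, \<omega>)"
    by (simp add: dual_objective_def inner_diff_right inner_commute algebra_simps)
  also have "\<dots> \<le> lower_objective D w"
    using weak_duality[OF D z' _ y] w by (cases w) blast
  finally show "ereal (f + (- (regularizer D / 2) *\<^sub>R (\<omega> * \<omega>)) \<bullet> (z' - z)) \<le> ereal (lower_objective D w)"
    by simp
qed

section \<open>Termination of transition systems\<close>

lemma terminatesI:
  fixes \<mu> :: "'c \<Rightarrow> nat"
  assumes init: "I init" and pres: "\<And>c c'. I c \<Longrightarrow> step c c' \<Longrightarrow> I c'"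
    and dec: "\<And>c c'. I c \<Longrightarrow> step c c' \<Longrightarrow> \<mu> c' < \<mu> c"
    and progress: "\<And>c. I c \<Longrightarrow> \<not> final c \<Longrightarrow> \<exists>c'. step c c'"
  shows "terminates step init final"
  unfolding terminates_def
proof (intro conjI allI impI notI)
  assume "\<exists>\<sigma>. \<sigma> 0 = init \<and> (\<forall>i::nat. step (\<sigma> i) (\<sigma> (Suc i)))"
  then obtain \<sigma> where \<sigma>: "\<sigma> 0 = init" "\<And>i::nat. step (\<sigma> i) (\<sigma> (Suc i))" by blast
  have I: "I (\<sigma> i)" for i by (induction i) (use init pres \<sigma> in auto)
  have "\<mu> (\<sigma> i) + i \<le> \<mu> (\<sigma> 0)" for i
  proof (induction i)
    case (Suc i)
    then show ?case using dec[OF I \<sigma>(2), of i] by simp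
  qed simp
  from this[of "Suc (\<mu> (\<sigma> 0))"] show False by simp
next
  fix c assume c: "step\<^sup>*\<^sup>* init c \<and> \<not> final c"
  have "step\<^sup>*\<^sup>* init c \<Longrightarrow> I c" for c by (induction rule: rtranclp_induct) (use init pres in auto)
  then show "\<exists>c'. step c c'" using c progress by blast
qed

text \<open>By dependent choice, a system that never gets stuck and avoids the final states could run forever.\<close>

lemma terminates_reaches_final:
  assumes "terminates step init final"
  shows "\<exists>c. step\<^sup>*\<^sup>* init c \<and> final c"
proof (rule ccontr)
  assume "\<nexists>c. step\<^sup>*\<^sup>* init c \<and> final c"
  then have nf: "\<not> final c" if "step\<^sup>*\<^sup>* init c" for c using that by blast
  have "\<exists>\<sigma>. \<forall>n::nat. (step\<^sup>*\<^sup>* init (\<sigma> n) \<and> (n = 0 \<longrightarrow> \<sigma> n = init)) \<and> step (\<sigma> n) (\<sigma> (Suc n))"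
  proof (rule dependent_nat_choice)
    fix c and n :: nat assume c: "step\<^sup>*\<^sup>* init c \<and> (n = 0 \<longrightarrow> c = init)"
    then obtain c' where "step c c'" using assms nf unfolding terminates_def by blast
    then show "\<exists>c'. (step\<^sup>*\<^sup>* init c' \<and> (Suc n = 0 \<longrightarrow> c' = init)) \<and> step c c'"
      using c by (auto intro: rtranclp.rtrancl_into_rtrancl)
  qed auto
  then show False using assms unfolding terminates_def by blast
qed

section \<open>The lower-level algorithm\<close>

primrec lower_invariant ::
  "('n::finite, 'm::finite, 's::finite) portfolio_data \<Rightarrow> real \<Rightarrow> real ^ 'n
     \<Rightarrow> ('n, 's) lower_state \<Rightarrow> bool" where
  "lower_invariant D \<delta> z (Lower_Running G K) \<longleftrightarrow> UNIV \<in> K \<and> G = relaxed_set D z K"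
| "lower_invariant D \<delta> z (Lower_Done a v v' x K) \<longleftrightarrow>
     (\<exists>J K'. K = insert J K' \<and> UNIV \<in> K' \<and>
        is_arg_min (lower_objective D) (\<lambda>w. w \<in> relaxed_set D z K') (a, v, x) \<and>
        v' = tail_value D z a x \<and> v' - v \<le> \<delta>)"

lemma lower_invariant_init: "lower_invariant D \<delta> z (lower_init D z)"
  by (simp add: lower_init_def lower_initial_set_eq)

lemma lower_invariant_step:
  "lower_step D \<delta> z c c' \<Longrightarrow> lower_invariant D \<delta> z c \<Longrightarrow> lower_invariant D \<delta> z c'"
  by (induction rule: lower_step.induct) (auto simp: relaxed_set_insert)

text \<open>Every continuing iteration adds a new scenario set to the family, and stopping is worth one more.\<close>

primrec lower_measure :: "('n::finite, 's::finite) lower_state \<Rightarrow> nat" where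
  "lower_measure (Lower_Running G K) = Suc (card (- K))"
| "lower_measure (Lower_Done a v v' x K) = 0"

text \<open>A tail that already belongs to the family has its cut satisfied by the current point, so the gap
\<open>v' - v\<close> would be at most zero and the algorithm would have stopped.\<close>

lemma lower_step_new_tail:
  assumes "0 \<le> \<delta>" "(a, v, x) \<in> relaxed_set D z K" "\<not> tail_value D z a x - v \<le> \<delta>"
  shows "tail_scenarios D z a x \<notin> K"
proof
  assume "tail_scenarios D z a x \<in> K"
  with assms(2) have "(a, v, x) \<in> tail_cut D z (tail_scenarios D z a x)"
    by (auto simp: relaxed_set_def)
  then have "tail_value D z a x \<le> v" by (simp add: tail_cut_def tail_value_def)
  with assms show False by simp
qed

lemma lower_terminates:
  fixes D :: "('n::finite, 'm::finite, 's::finite) portfolio_data"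
  assumes D: "valid_data D" and "0 \<le> \<delta>" and ne: "lower_initial_set D z \<noteq> {}"
  shows "terminates (lower_step D \<delta> z) (lower_init D z) lower_done"
proof (rule terminatesI[where I = "lower_invariant D \<delta> z" and \<mu> = lower_measure])
  fix c c' assume "lower_invariant D \<delta> z c" "lower_step D \<delta> z c c'"
  from this(2,1) show "lower_measure c' < lower_measure c"
  proof cases
    case (lower_continue G a v x J v' K)
    with \<open>lower_invariant D \<delta> z c\<close> have "J \<notin> K"
      using lower_step_new_tail[OF \<open>0 \<le> \<delta>\<close>, of a v x D z K] by (auto simp: is_arg_min_def)
    then have "- insert J K \<subset> - K" by blast
    with lower_continue show ?thesis by (auto intro: psubset_card_mono)
  qed simp
next
  fix c assume I: "lower_invariant D \<delta> z c" and nd: "\<not> lower_done c"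
  then obtain G K where c: "c = Lower_Running G K" by (cases c) (auto simp: lower_done_def)
  with I obtain a v x where "is_arg_min (lower_objective D) (\<lambda>w. w \<in> G) (a, v, x)"
    using relaxed_minimum_exists[OF D _ relaxed_set_nonempty[OF D ne], of K] by auto
  then show "\<exists>c'. lower_step D \<delta> z c c'"
    unfolding c
    using lower_stop[OF _ refl refl, of D G a v x z \<delta> K] lower_continue[OF _ refl refl, of D G a v x z \<delta> K]
    by blast
qed (auto intro: lower_invariant_init lower_invariant_step)

lemma lower_result:
  assumes "(lower_step D \<delta> z)\<^sup>*\<^sup>* (lower_init D z) c"
  shows "lower_invariant D \<delta> z c"
  using assms by (induction rule: rtranclp_induct) (auto intro: lower_invariant_init lower_invariant_step)

section \<open>The bilevel algorithm\<close>

text \<open>On binary vectors the left-hand side of the feasibility cut is the Hamming distance.\<close>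

lemma binary_distance_ge_1:
  fixes z z' :: "real ^ 'n::finite"
  assumes "\<And>n. z $ n = 0 \<or> z $ n = 1" "\<And>n. z' $ n = 0 \<or> z' $ n = 1" "z' \<noteq> z"
  shows "1 \<le> z \<bullet> (1 - z') + (1 - z) \<bullet> z'"
proof -
  have eq: "z \<bullet> (1 - z') + (1 - z) \<bullet> z' = (\<Sum>n\<in>UNIV. \<bar>z $ n - z' $ n\<bar>)"
    unfolding inner_vec_def sum.distrib[symmetric]
  proof (rule sum.cong)
    fix n show "z $ n \<bullet> (1 - z') $ n + (1 - z) $ n \<bullet> z' $ n = \<bar>z $ n - z' $ n\<bar>"
      using assms(1)[of n] assms(2)[of n] by auto
  qed simp
  obtain m where "z' $ m \<noteq> z $ m" using assms(3) by (auto simp: vec_eq_iff)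
  then have "1 \<le> \<bar>z $ m - z' $ m\<bar>" using assms(1)[of m] assms(2)[of m] by auto
  also have "\<dots> \<le> (\<Sum>n\<in>UNIV. \<bar>z $ n - z' $ n\<bar>)" by (rule member_le_sum) auto
  finally show ?thesis by (simp add: eq)
qed

lemma binary_distance_self:
  fixes z :: "real ^ 'n::finite"
  assumes "\<And>n. z $ n = 0 \<or> z $ n = 1"
  shows "z \<bullet> (1 - z) + (1 - z) \<bullet> z = 0"
proof -
  have "z $ n \<bullet> (1 - z) $ n = 0" for n using assms[of n] by auto
  then have "z \<bullet> (1 - z) = 0" by (simp only: inner_vec_def sum.neutral_const)
  then show ?thesis by (simp add: inner_commute)
qed

text \<open>The first condition says that the master problem is a relaxation: it contains the epigraph of \<open>f\<close> over the
supports. The next two conditions guarantee that it has a minimiser, since over each of the finitely many supports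
it has a closed slice that is bounded below. The condition on visited supports expresses that the
cut made at such a support is tight there up to \<open>\<delta>\<close> or, in the infeasible case, has removed the
support; thus a repeated support certifies the optimality gap \<open>\<delta>\<close>. The incumbent realises the upper bound. The last
condition is the certificate that both stopping criteria provide.\<close>

definition bilevel_invariant ::
  "('n::finite, 'm::finite, 's::finite) portfolio_data \<Rightarrow> real \<Rightarrow> real \<Rightarrow> real
     \<Rightarrow> 'n bilevel_state \<Rightarrow> bool" where
  "bilevel_invariant D \<theta>\<^sub>L\<^sub>B \<epsilon> \<delta> \<sigma> \<longleftrightarrow>
     (\<forall>z\<in>supports D. \<forall>\<theta>. lower_value D z \<le> ereal \<theta> \<longrightarrow> (z, \<theta>) \<in> master_set \<sigma>) \<and>
     (\<forall>(z, \<theta>)\<in>master_set \<sigma>. z \<in> supports D \<and> \<theta>\<^sub>L\<^sub>B \<le> \<theta>) \<and>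
     (\<forall>z. closed {\<theta>. (z, \<theta>) \<in> master_set \<sigma>}) \<and>
     visited \<sigma> \<subseteq> supports D \<and>
     (\<forall>z\<in>visited \<sigma>. \<forall>\<theta>. (z, \<theta>) \<in> master_set \<sigma> \<longrightarrow> upper_bound \<sigma> \<le> ereal (\<theta> + \<delta>)) \<and>
     (upper_bound \<sigma> = \<infinity> \<or>
        (\<exists>z \<theta>. incumbent \<sigma> = Some (z, \<theta>) \<and> z \<in> supports D \<and> lower_value D z \<le> upper_bound \<sigma>)) \<and>
     (halted \<sigma> \<longrightarrow>
        (\<exists>\<theta>. ereal \<theta> \<le> optimal_value D \<and> upper_bound \<sigma> \<le> ereal (\<theta> + max \<delta> \<epsilon>)))"

lemma optimal_value_le:
  "z \<in> supports D \<Longrightarrow> optimal_value D \<le> lower_value D z"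
  by (simp add: optimal_value_def finite_supports)

lemma bilevel_invariant_init:
  assumes "ereal \<theta>\<^sub>L\<^sub>B \<le> optimal_value D"
  shows "bilevel_invariant D \<theta>\<^sub>L\<^sub>B \<epsilon> \<delta> (bilevel_init D \<theta>\<^sub>L\<^sub>B)"
proof -
  have "\<theta>\<^sub>L\<^sub>B \<le> \<theta>" if "z \<in> supports D" "lower_value D z \<le> ereal \<theta>" for z \<theta>
    using order_trans[OF assms order_trans[OF optimal_value_le[OF that(1)] that(2)]] by simp
  moreover have "closed {\<theta>. z \<in> supports D \<and> \<theta>\<^sub>L\<^sub>B \<le> \<theta>}" for z
    by (cases "z \<in> supports D") (simp_all flip: atLeast_def)
  ultimately show ?thesis by (simp add: bilevel_invariant_def bilevel_init_def)
qed

lemma master_minimum_le_optimal_value: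
  fixes D :: "('n::finite, 'm::finite, 's::finite) portfolio_data"
  assumes I: "bilevel_invariant D \<theta>\<^sub>L\<^sub>B \<epsilon> \<delta> \<sigma>" and ne: "supports D \<noteq> {}"
    and min: "is_arg_min snd (\<lambda>y. y \<in> master_set \<sigma>) (z, \<theta>)"
  shows "ereal \<theta> \<le> optimal_value D"
proof -
  have "ereal \<theta> \<le> lower_value D z'" if z': "z' \<in> supports D" for z'
  proof (rule ccontr)
    assume "\<not> ereal \<theta> \<le> lower_value D z'"
    then obtain \<theta>' where "lower_value D z' < ereal \<theta>'" "ereal \<theta>' < ereal \<theta>"
      using ereal_dense2 by (metis not_le)
    moreover from this I z' have "(z', \<theta>') \<in> master_set \<sigma>"
      unfolding bilevel_invariant_def by (meson less_imp_le)
    ultimately show False using min by (force simp: is_arg_min_linorder)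
  qed
  then show ?thesis using ne by (simp add: optimal_value_def finite_supports)
qed

text \<open>Over each support the least admissible \<open>\<theta>\<close> is the infimum of the slice; the best of these over the
finitely many supports with a nonempty slice is the minimum.\<close>

lemma master_minimum_exists:
  fixes D :: "('n::finite, 'm::finite, 's::finite) portfolio_data"
  assumes I: "bilevel_invariant D \<theta>\<^sub>L\<^sub>B \<epsilon> \<delta> \<sigma>" and feas: "\<exists>z\<in>supports D. lower_value D z < \<infinity>"
  shows "\<exists>z \<theta>. is_arg_min snd (\<lambda>y. y \<in> master_set \<sigma>) (z, \<theta>)"
proof -
  define slice where "slice z = {\<theta>. (z, \<theta>) \<in> master_set \<sigma>}" for z
  define Z where "Z = {z \<in> supports D. slice z \<noteq> {}}"
  obtain z0 where "z0 \<in> supports D" "lower_value D z0 < \<infinity>" using feas by blast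
  moreover from this obtain \<theta>0 where "lower_value D z0 < ereal \<theta>0"
    using ereal_dense2 by blast
  ultimately have "(z0, \<theta>0) \<in> master_set \<sigma>"
    using I unfolding bilevel_invariant_def by (meson less_imp_le)
  then have "Z \<noteq> {}" using \<open>z0 \<in> supports D\<close> by (auto simp: Z_def slice_def)
  moreover have "finite Z" by (simp add: Z_def finite_supports)
  ultimately obtain z where z: "is_arg_min (\<lambda>z. Inf (slice z)) (\<lambda>z. z \<in> Z) z"
    using ex_is_arg_min_if_finite by metis
  have bdd: "bdd_below (slice z)" for z
    using I unfolding bilevel_invariant_def slice_def by (intro bdd_belowI[of _ "\<theta>\<^sub>L\<^sub>B"]) auto
  have "slice z \<noteq> {}" using z by (simp add: is_arg_min_def Z_def)
  moreover have "closed (slice z)" using I by (simp add: bilevel_invariant_def slice_def)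
  ultimately have "Inf (slice z) \<in> slice z" using bdd closed_contains_Inf by blast
  moreover have "Inf (slice z) \<le> \<theta>'" if "(z', \<theta>') \<in> master_set \<sigma>" for z' \<theta>'
  proof -
    have "z' \<in> Z" using I that by (auto simp: bilevel_invariant_def Z_def slice_def)
    with z have "Inf (slice z) \<le> Inf (slice z')" by (simp add: is_arg_min_linorder)
    also have "\<dots> \<le> \<theta>'" using that by (intro cInf_lower bdd) (simp add: slice_def)
    finally show ?thesis .
  qed
  ultimately have "is_arg_min snd (\<lambda>y. y \<in> master_set \<sigma>) (z, Inf (slice z))"
    by (auto simp: is_arg_min_linorder slice_def)
  then show ?thesis by blast
qed

text \<open>What both kinds of cut have in common. The cut must keep the epigraph of \<open>f\<close>, and at the current
support it must push \<open>\<theta>\<close> up to within \<open>\<delta>\<close> of the upper bound. The stopping certificate follows from the state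
before the cut: at a repeated support the tightness condition already bounds the upper bound by \<open>\<theta> + \<delta>\<close>.\<close>

lemma bilevel_invariant_cut:
  fixes D :: "('n::finite, 'm::finite, 's::finite) portfolio_data"
  assumes I: "bilevel_invariant D \<theta>\<^sub>L\<^sub>B \<epsilon> \<delta> \<sigma>" and ne: "supports D \<noteq> {}"
    and min: "is_arg_min snd (\<lambda>y. y \<in> master_set \<sigma>) (z, \<theta>)"
    and valid: "\<And>z' \<theta>'. z' \<in> supports D \<Longrightarrow> lower_value D z' \<le> ereal \<theta>' \<Longrightarrow> (z', \<theta>') \<in> C"
    and closed: "\<And>z'. closed {\<theta>'. (z', \<theta>') \<in> C}"
    and UB: "UB \<le> upper_bound \<sigma>"
    and tight: "\<And>\<theta>'. (z, \<theta>') \<in> C \<Longrightarrow> UB \<le> ereal (\<theta>' + \<delta>)"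
    and inc: "UB = \<infinity> \<or> (\<exists>z \<theta>. i = Some (z, \<theta>) \<and> z \<in> supports D \<and> lower_value D z \<le> UB)"
  shows "bilevel_invariant D \<theta>\<^sub>L\<^sub>B \<epsilon> \<delta>
    \<lparr> master_set = master_set \<sigma> \<inter> C, upper_bound = UB, incumbent = i,
      visited = insert z (visited \<sigma>), halted = (z \<in> visited \<sigma> \<or> UB - ereal \<theta> \<le> ereal \<epsilon>) \<rparr>"
proof -
  have mem: "(z, \<theta>) \<in> master_set \<sigma>" using min by (simp add: is_arg_min_def)
  then have z: "z \<in> supports D" using I by (auto simp: bilevel_invariant_def)
  have visited: "UB \<le> ereal (\<theta>' + \<delta>)" if "z' \<in> visited \<sigma>" "(z', \<theta>') \<in> master_set \<sigma>" for z' \<theta>'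
    using I UB that unfolding bilevel_invariant_def by (meson order_trans)
  \<comment> \<open>Either stopping criterion gives its own tolerance, which is at most the larger one.\<close>
  have mono: "UB \<le> ereal (\<theta> + max \<delta> \<epsilon>)" if "UB \<le> ereal (\<theta> + e)" "e = \<delta> \<or> e = \<epsilon>" for e
    using that by (elim order_trans) auto
  have "UB \<le> ereal (\<theta> + max \<delta> \<epsilon>)" if "z \<in> visited \<sigma> \<or> UB - ereal \<theta> \<le> ereal \<epsilon>"
    using that
  proof
    assume "z \<in> visited \<sigma>"
    from visited[OF this mem] show ?thesis by (rule mono) simp
  next
    assume "UB - ereal \<theta> \<le> ereal \<epsilon>"
    then have "UB \<le> ereal (\<theta> + \<epsilon>)" by (cases UB) auto
    then show ?thesis by (rule mono) simp
  qed
  moreover note master_minimum_le_optimal_value[OF I ne min]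
  moreover have "closed {\<theta>'. (z', \<theta>') \<in> master_set \<sigma> \<inter> C}" for z'
  proof -
    have "{\<theta>'. (z', \<theta>') \<in> master_set \<sigma> \<inter> C}
        = {\<theta>'. (z', \<theta>') \<in> master_set \<sigma>} \<inter> {\<theta>'. (z', \<theta>') \<in> C}" by blast
    then show ?thesis using I closed by (simp add: bilevel_invariant_def closed_Int)
  qed
  ultimately show ?thesis
    using I valid visited tight inc z unfolding bilevel_invariant_def by auto
qed

lemma lower_value_le_corrected:
  assumes "lower_invariant D \<delta> z (Lower_Done a v v' x K)"
  shows "lower_value D z \<le> ereal (lower_objective D (a, v', x))"
proof -
  from assms obtain K' where "(a, v, x) \<in> relaxed_set D z K'" "v' = tail_value D z a x"
    by (auto simp: is_arg_min_def)
  then have "(a, v', x) \<in> lower_feasible D z" using corrected_point_lower_feasible by blast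
  then show ?thesis unfolding lower_value_def by (rule INF_lower)
qed

lemma bilevel_invariant_step:
  fixes D :: "('n::finite, 'm::finite, 's::finite) portfolio_data"
  assumes D: "valid_data D" and ne: "supports D \<noteq> {}"
    and step: "bilevel_step D \<epsilon> \<delta> \<sigma> \<sigma>'" and I: "bilevel_invariant D \<theta>\<^sub>L\<^sub>B \<epsilon> \<delta> \<sigma>"
  shows "bilevel_invariant D \<theta>\<^sub>L\<^sub>B \<epsilon> \<delta> \<sigma>'"
  using step
proof cases
  case (infeasible_cut z \<theta> UB)
  let ?C = "{(z', \<theta>'). z' \<in> supports D \<and> z \<bullet> (1 - z') + (1 - z) \<bullet> z' \<ge> 1}"
  have z: "z \<in> supports D"
    using I infeasible_cut(3) by (auto simp: bilevel_invariant_def is_arg_min_def)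
  note bin = supports_binary[OF z]
  have inf: "lower_value D z = \<infinity>"
    using infeasible_cut(4) lower_initial_set_empty_iff[OF D]
    by (simp add: lower_value_def top_ereal_def)
  show ?thesis
    unfolding infeasible_cut(1) infeasible_cut(5)
  proof (rule bilevel_invariant_cut[OF I ne infeasible_cut(3)])
    fix z' \<theta>' assume z': "z' \<in> supports D" "lower_value D z' \<le> ereal \<theta>'"
    then have "z' \<noteq> z" using inf by auto
    then show "(z', \<theta>') \<in> ?C"
      using binary_distance_ge_1[OF bin supports_binary[OF z'(1)]] z' by simp
  next
    show "closed {\<theta>'. (z', \<theta>') \<in> ?C}" for z' by simp
    show "upper_bound \<sigma> \<le> ereal (\<theta>' + \<delta>)" if "(z, \<theta>') \<in> ?C" for \<theta>'
      using that binary_distance_self[OF bin] by simp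
    show "upper_bound \<sigma> = \<infinity> \<or>
        (\<exists>z \<theta>. incumbent \<sigma> = Some (z, \<theta>) \<and> z \<in> supports D \<and> lower_value D z \<le> upper_bound \<sigma>)"
      using I unfolding bilevel_invariant_def by blast
  qed simp
next
  case (optimality_cut z \<theta> a v v' x K f fhat \<alpha> \<zeta> l \<omega> g UB inc)
  let ?C = "{(z', \<theta>'). z' \<in> supports D \<and> \<theta>' \<ge> f + g \<bullet> (z' - z)}"
  have z: "z \<in> supports D"
    using I optimality_cut(3) by (auto simp: bilevel_invariant_def is_arg_min_def)
  note res = lower_result[OF optimality_cut(5)]
  from res obtain J K' where K: "K = insert J K'" "UNIV \<in> K'"
    and opt: "is_arg_min (lower_objective D) (\<lambda>w. w \<in> relaxed_set D z K') (a, v, x)"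
    and gap: "v' - v \<le> \<delta>" by auto
  have f: "f \<le> dual_objective D z (\<alpha>, \<zeta>, l, \<omega>)"
    unfolding optimality_cut(6)
    by (rule relaxed_minimum_le_dual_optimum[OF D z optimality_cut(4) K(2) opt])
      (use optimality_cut(8) K in simp)
  have y: "(\<alpha>, \<zeta>, l, \<omega>) \<in> dual_feasible D K"
    using optimality_cut(8) by (simp add: dual_optimal_def is_arg_max_def)
  have UB: "UB \<le> upper_bound \<sigma>" "UB \<le> ereal fhat"
    using optimality_cut(10) by (auto split: if_splits)
  have fhat: "fhat \<le> f + \<delta>" using gap optimality_cut(6,7) by (simp add: lower_objective_def)
  show ?thesis
    unfolding optimality_cut(1)
  proof (rule bilevel_invariant_cut[OF I ne optimality_cut(3) _ _ UB(1)])
    fix z' \<theta>' assume z': "z' \<in> supports D" "lower_value D z' \<le> ereal \<theta>'"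
    have "ereal (f + g \<bullet> (z' - z)) \<le> ereal \<theta>'"
      using optimality_cut_valid[OF D z'(1) y f] z'(2) unfolding optimality_cut(9) by (rule order_trans)
    then show "(z', \<theta>') \<in> ?C" using z' by simp
  next
    show "closed {\<theta>'. (z', \<theta>') \<in> ?C}" for z'
      by (cases "z' \<in> supports D") (simp_all flip: atLeast_def)
    show "UB \<le> ereal (\<theta>' + \<delta>)" if "(z, \<theta>') \<in> ?C" for \<theta>'
      using that UB(2) fhat by (elim order_trans) simp
    show "UB = \<infinity> \<or> (\<exists>z \<theta>. inc = Some (z, \<theta>) \<and> z \<in> supports D \<and> lower_value D z \<le> UB)"
    proof (cases "ereal fhat < upper_bound \<sigma>")
      case True
      then show ?thesis
        using optimality_cut(10) z lower_value_le_corrected[OF res]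
        by (simp add: optimality_cut(7))
    next
      case False
      then show ?thesis
        using optimality_cut(10) I unfolding bilevel_invariant_def by auto
    qed
  qed
qed

lemma bilevel_step_exists:
  fixes D :: "('n::finite, 'm::finite, 's::finite) portfolio_data"
  assumes D: "valid_data D" and \<delta>: "0 \<le> \<delta>" and feas: "\<exists>z\<in>supports D. lower_value D z < \<infinity>"
    and I: "bilevel_invariant D \<theta>\<^sub>L\<^sub>B \<epsilon> \<delta> \<sigma>" and run: "\<not> halted \<sigma>"
  shows "\<exists>\<sigma>'. bilevel_step D \<epsilon> \<delta> \<sigma> \<sigma>'"
proof -
  obtain z \<theta> where min: "is_arg_min snd (\<lambda>y. y \<in> master_set \<sigma>) (z, \<theta>)"
    using master_minimum_exists[OF I feas] by blast
  then have z: "z \<in> supports D" using I by (auto simp: bilevel_invariant_def is_arg_min_def)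
  show ?thesis
  proof (cases "lower_initial_set D z = {}")
    case True
    show ?thesis by (rule exI) (rule infeasible_cut[OF run min True refl])
  next
    case False
    obtain c where c: "(lower_step D \<delta> z)\<^sup>*\<^sup>* (lower_init D z) c" and "lower_done c"
      using terminates_reaches_final[OF lower_terminates[OF D \<delta> False]] by blast
    then obtain a v v' x K where fin: "c = Lower_Done a v v' x K" by (auto simp: lower_done_def)
    then have "UNIV \<in> K" using lower_result[OF c] by auto
    then obtain \<alpha> \<zeta> l \<omega> where y: "dual_optimal D K z (\<alpha>, \<zeta>, l, \<omega>)"
      using dual_optimum_exists[OF D z False] by blast
    obtain UB inc where "(UB, inc) =
        (if ereal (lower_objective D (a, v', x)) < upper_bound \<sigma>
         then (ereal (lower_objective D (a, v', x)), Some (z, \<theta>))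
         else (upper_bound \<sigma>, incumbent \<sigma>))" by (metis surj_pair)
    from optimality_cut[OF run min False c[unfolded fin] refl refl y refl this]
    show ?thesis by blast
  qed
qed

text \<open>A run continues only as long as it visits new supports, of which there are finitely many.\<close>

lemma bilevel_step_visits:
  assumes "bilevel_step D \<epsilon> \<delta> \<sigma> \<sigma>'"
  shows "\<not> halted \<sigma> \<and> (\<exists>z \<theta>. (z, \<theta>) \<in> master_set \<sigma> \<and> visited \<sigma>' = insert z (visited \<sigma>)
            \<and> (z \<in> visited \<sigma> \<longrightarrow> halted \<sigma>'))"
  using assms
proof cases
  case (infeasible_cut z \<theta> UB)
  then show ?thesis
    by (intro conjI exI[of _ z] exI[of _ \<theta>]) (simp_all add: is_arg_min_def)
next
  case (optimality_cut z \<theta> a v v' x K f fhat \<alpha> \<zeta> l \<omega> g UB inc)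
  then show ?thesis
    by (intro conjI exI[of _ z] exI[of _ \<theta>]) (simp_all add: is_arg_min_def)
qed

lemma bilevel_terminates:
  fixes D :: "('n::finite, 'm::finite, 's::finite) portfolio_data"
  assumes D: "valid_data D" and \<delta>: "0 \<le> \<delta>" and feas: "\<exists>z\<in>supports D. lower_value D z < \<infinity>"
    and lb: "ereal \<theta>\<^sub>L\<^sub>B \<le> optimal_value D"
  shows "terminates (bilevel_step D \<epsilon> \<delta>) (bilevel_init D \<theta>\<^sub>L\<^sub>B) halted"
proof (rule terminatesI[where I = "bilevel_invariant D \<theta>\<^sub>L\<^sub>B \<epsilon> \<delta>"
      and \<mu> = "\<lambda>\<sigma>. if halted \<sigma> then 0 else Suc (card (supports D - visited \<sigma>))"])
  fix \<sigma> \<sigma>' assume I: "bilevel_invariant D \<theta>\<^sub>L\<^sub>B \<epsilon> \<delta> \<sigma>" and step: "bilevel_step D \<epsilon> \<delta> \<sigma> \<sigma>'"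
  from step obtain z \<theta> where run: "\<not> halted \<sigma>" and vis: "visited \<sigma>' = insert z (visited \<sigma>)"
    and halt: "z \<in> visited \<sigma> \<Longrightarrow> halted \<sigma>'" and "(z, \<theta>) \<in> master_set \<sigma>"
    using bilevel_step_visits by blast
  then have "z \<in> supports D" using I by (auto simp: bilevel_invariant_def)
  then have "supports D - visited \<sigma>' \<subset> supports D - visited \<sigma>" if "z \<notin> visited \<sigma>"
    using vis that by blast
  then have "card (supports D - visited \<sigma>') < card (supports D - visited \<sigma>)" if "z \<notin> visited \<sigma>"
    using that by (intro psubset_card_mono) (auto simp: finite_supports)
  then show "(if halted \<sigma>' then 0 else Suc (card (supports D - visited \<sigma>')))
      < (if halted \<sigma> then 0 else Suc (card (supports D - visited \<sigma>)))"
    using run halt by auto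
next
  have "supports D \<noteq> {}" using feas by blast
  then show "bilevel_invariant D \<theta>\<^sub>L\<^sub>B \<epsilon> \<delta> \<sigma>'"
    if "bilevel_invariant D \<theta>\<^sub>L\<^sub>B \<epsilon> \<delta> \<sigma>" "bilevel_step D \<epsilon> \<delta> \<sigma> \<sigma>'" for \<sigma> \<sigma>'
    by (rule bilevel_invariant_step[OF D _ that(2,1)])
qed (rule bilevel_invariant_init[OF lb], rule bilevel_step_exists[OF D \<delta> feas])

theorem theorem4:
  fixes D :: "('n::finite, 'm::finite, 's::finite) portfolio_data"
    and \<epsilon> \<delta> \<theta>\<^sub>L\<^sub>B :: real
  assumes "valid_data D"
    and "\<epsilon> \<ge> 0" and "\<delta> \<ge> 0"
    and "\<exists>z\<in>supports D. lower_value D z < \<infinity>"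
    and "ereal \<theta>\<^sub>L\<^sub>B \<le> optimal_value D"
  shows
    "(\<forall>z\<in>supports D. lower_initial_set D z \<noteq> {} \<longrightarrow>
        terminates (lower_step D \<delta> z) (lower_init D z) lower_done) \<and>
     terminates (bilevel_step D \<epsilon> \<delta>) (bilevel_init D \<theta>\<^sub>L\<^sub>B) halted \<and>
     (\<forall>\<sigma>. (bilevel_step D \<epsilon> \<delta>)\<^sup>*\<^sup>* (bilevel_init D \<theta>\<^sub>L\<^sub>B) \<sigma> \<and> halted \<sigma> \<longrightarrow>
        (\<exists>z\<^sub>o\<^sub>u\<^sub>t \<theta>\<^sub>o\<^sub>u\<^sub>t. incumbent \<sigma> = Some (z\<^sub>o\<^sub>u\<^sub>t, \<theta>\<^sub>o\<^sub>u\<^sub>t) \<and>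
           z\<^sub>o\<^sub>u\<^sub>t \<in> supports D \<and>
           optimal_value D \<le> lower_value D z\<^sub>o\<^sub>u\<^sub>t \<and>
           lower_value D z\<^sub>o\<^sub>u\<^sub>t \<le> optimal_value D + ereal (max \<delta> \<epsilon>)))"
proof (intro conjI ballI allI impI)
  show "terminates (lower_step D \<delta> z) (lower_init D z) lower_done"
    if "lower_initial_set D z \<noteq> {}" for z
    using lower_terminates[OF assms(1,3) that] .
  show "terminates (bilevel_step D \<epsilon> \<delta>) (bilevel_init D \<theta>\<^sub>L\<^sub>B) halted"
    using bilevel_terminates[OF assms(1,3,4,5)] .
next
  fix \<sigma> assume \<sigma>: "(bilevel_step D \<epsilon> \<delta>)\<^sup>*\<^sup>* (bilevel_init D \<theta>\<^sub>L\<^sub>B) \<sigma> \<and> halted \<sigma>"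
  from \<sigma>[THEN conjunct1] have "bilevel_invariant D \<theta>\<^sub>L\<^sub>B \<epsilon> \<delta> \<sigma>"
  proof (induction rule: rtranclp_induct)
    case base
    show ?case using bilevel_invariant_init[OF assms(5)] .
  next
    case (step \<sigma> \<sigma>')
    show ?case using bilevel_invariant_step[OF assms(1) _ step(2,3)] assms(4) by blast
  qed
  then obtain \<theta> where \<theta>: "ereal \<theta> \<le> optimal_value D" and UB: "upper_bound \<sigma> \<le> ereal (\<theta> + max \<delta> \<epsilon>)"
    and "upper_bound \<sigma> = \<infinity> \<or>
      (\<exists>z \<theta>. incumbent \<sigma> = Some (z, \<theta>) \<and> z \<in> supports D \<and> lower_value D z \<le> upper_bound \<sigma>)"
    using \<sigma> unfolding bilevel_invariant_def by blast
  then obtain z \<theta>' where z: "incumbent \<sigma> = Some (z, \<theta>')" "z \<in> supports D"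
    and le: "lower_value D z \<le> upper_bound \<sigma>" by auto
  have "lower_value D z \<le> ereal \<theta> + ereal (max \<delta> \<epsilon>)" using order_trans[OF le UB] by (simp only: plus_ereal.simps)
  also have "\<dots> \<le> optimal_value D + ereal (max \<delta> \<epsilon>)" using \<theta> by (rule add_right_mono)
  finally show "\<exists>z\<^sub>o\<^sub>u\<^sub>t \<theta>\<^sub>o\<^sub>u\<^sub>t. incumbent \<sigma> = Some (z\<^sub>o\<^sub>u\<^sub>t, \<theta>\<^sub>o\<^sub>u\<^sub>t) \<and> z\<^sub>o\<^sub>u\<^sub>t \<in> supports D \<and>
      optimal_value D \<le> lower_value D z\<^sub>o\<^sub>u\<^sub>t \<and> lower_value D z\<^sub>o\<^sub>u\<^sub>t \<le> optimal_value D + ereal (max \<delta> \<epsilon>)"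
    using z optimal_value_le by blast
qed

end
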